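(* Let $H:T^*\mathbb T^d\times\mathbb R\to\mathbb R$ be $C^k$, $k\ge3$, satisfying the standard hypotheses and the growth condition in the context. For $\varepsilon>0$ let $\phi_\varepsilon$ be a time-periodic solution on $\mathbb T^d\times\mathbb S^1$ of $$\phi_t+\varepsilon\Delta\phi+H(x,D\phi,t)=c(\varepsilon).$$ Then the solutions $\phi_\varepsilon$ have uniformly bounded derivative: there is a constant $C$ independent of $\varepsilon>0$ such that $|D\phi_\varepsilon(x,t)|\le C$ and $|\partial_t\phi_\varepsilon(x,t)|\le C$ for all $(x,t)$.
   Context: $\mathbb S^1=\mathbb R/\mathbb Z$; $D$ and $\Delta$ are the gradient and Laplacian in $x\in\mathbb T^d$. Standard hypotheses: (Convexity) $H_{pp}(x,p,t)$ is positive definite; (Superlinearity) $H(x,p,t)/|p|\to\infty$ as $|p|\to\infty$, uniformly in $x,t$; (Periodicity) $H(x,p,t+1)=H(x,p,t)$; (Completeness) the Hamiltonian flow on $T^*\mathbb T^d\times\mathbb S^1$ is complete. Growth condition: there is $K>0$ such that for all $x,t$ and all $p$ with $|p|\ge K$, $\big(H_p\cdot p-H+\inf_{(x,t)}H(x,0,t)\big)K-|H_x|\ge0$, where $H,H_p,H_x$ are evaluated at $(x,p,t)$. For each $\varepsilon>0$ there is exactly one constant $c(\varepsilon)\in\mathbb R$ for which the equation $\phi_t+\varepsilon\Delta\phi+H(x,D\phi,t)=c(\varepsilon)$ has a time-periodic solution $\phi_\varepsilon:\mathbb T^d\times\mathbb S^1\to\mathbb R$, and $\phi_\varepsilon$ is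 unique up to an additive constant. *)

theory Defs
  imports "HOL-Analysis.Analysis"
begin

section \<open>Differential operators\<close>

text \<open>\<open>C_k k f\<close>: all iterated partial derivatives of \<open>f\<close> of order at most \<open>k\<close> exist and are
  continuous on the whole space.  The total differentiability demanded in the recursion
  follows from continuity of the partial derivatives, so this is the usual class \<open>C\<^sup>k\<close>.\<close>

primrec C_k :: "nat \<Rightarrow> ('a::euclidean_space \<Rightarrow> real) \<Rightarrow> bool" where
  "C_k 0 f \<longleftrightarrow> continuous_on UNIV f"
| "C_k (Suc k) f \<longleftrightarrow>
     (\<forall>x. f differentiable (at x)) \<and>
     (\<forall>b\<in>Basis. C_k k (\<lambda>x. frechet_derivative f (at x) b))"

definition grad :: "(real^'n::finite \<Rightarrow> real) \<Rightarrow> real^'n \<Rightarrow> real^'n" where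
  "grad f x = (\<chi> i. frechet_derivative f (at x) (axis i 1))"

definition hessian :: "(real^'n::finite \<Rightarrow> real) \<Rightarrow> real^'n \<Rightarrow> real^'n^'n" where
  "hessian f x = jacobian (grad f) (at x)"

definition laplacian :: "(real^'n::finite \<Rightarrow> real) \<Rightarrow> real^'n \<Rightarrow> real" where
  "laplacian f x = trace (hessian f x)"

definition positive_definite :: "real^'n::finite^'n \<Rightarrow> bool" where
  "positive_definite A \<longleftrightarrow> transpose A = A \<and> (\<forall>v. v \<noteq> 0 \<longrightarrow> v \<bullet> (A *v v) > 0)"

section \<open>Hamiltonians\<close>

text \<open>The cotangent bundle of the torus \<open>\<real>\<^sup>d/\<int>\<^sup>d\<close> is trivial, so a Hamiltonian on
  \<open>T\<^sup>*\<T>\<^sup>d \<times> \<real>\<close> is a function of \<open>(x, p, t) \<in> \<real>\<^sup>d \<times> \<real>\<^sup>d \<times> \<real>\<close> that is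
  \<open>\<int>\<^sup>d\<close>-periodic in \<open>x\<close>; here \<open>d = CARD('n)\<close>.\<close>

type_synonym 'n hamiltonian = "real^'n \<Rightarrow> real^'n \<Rightarrow> real \<Rightarrow> real"

definition torus_periodic :: "(real^'n::finite \<Rightarrow> 'b) \<Rightarrow> bool" where
  "torus_periodic f \<longleftrightarrow> (\<forall>x z. (\<forall>i. z $ i \<in> \<int>) \<longrightarrow> f (x + z) = f x)"

definition H_x :: "('n::finite) hamiltonian \<Rightarrow> real^'n \<Rightarrow> real^'n \<Rightarrow> real \<Rightarrow> real^'n" where
  "H_x H x p t = grad (\<lambda>y. H y p t) x"

definition H_p :: "('n::finite) hamiltonian \<Rightarrow> real^'n \<Rightarrow> real^'n \<Rightarrow> real \<Rightarrow> real^'n" where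
  "H_p H x p t = grad (\<lambda>q. H x q t) p"

definition H_pp :: "('n::finite) hamiltonian \<Rightarrow> real^'n \<Rightarrow> real^'n \<Rightarrow> real \<Rightarrow> real^'n^'n" where
  "H_pp H x p t = hessian (\<lambda>q. H x q t) p"

definition convexity :: "('n::finite) hamiltonian \<Rightarrow> bool" where
  "convexity H \<longleftrightarrow> (\<forall>x p t. positive_definite (H_pp H x p t))"

definition superlinearity :: "('n::finite) hamiltonian \<Rightarrow> bool" where
  "superlinearity H \<longleftrightarrow>
     (\<forall>M. \<forall>\<^sub>F p in at_infinity. \<forall>x t. H x p t / norm p \<ge> M)"

definition periodicity :: "('n::finite) hamiltonian \<Rightarrow> bool" where
  "periodicity H \<longleftrightarrow> (\<forall>x p t. H x p (t + 1) = H x p t)"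

text \<open>Every initial condition lies on an integral curve of the Hamiltonian vector field
  that is defined for all times.  The flow is lifted to \<open>\<real>\<^sup>d \<times> \<real>\<^sup>d \<times> \<real>\<close>,
  which affects neither existence nor the domain of the integral curves.\<close>

definition completeness :: "('n::finite) hamiltonian \<Rightarrow> bool" where
  "completeness H \<longleftrightarrow>
     (\<forall>x0 p0 t0. \<exists>x p. x t0 = x0 \<and> p t0 = p0 \<and>
        (\<forall>t. (x has_vector_derivative H_p H (x t) (p t) t) (at t)) \<and>
        (\<forall>t. (p has_vector_derivative - H_x H (x t) (p t) t) (at t)))"

definition standard_hypotheses :: "('n::finite) hamiltonian \<Rightarrow> bool" where
  "standard_hypotheses H \<longleftrightarrow>
     convexity H \<and> superlinearity H \<and> periodicity H \<and> completeness H"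

text \<open>For continuous, periodic \<open>H\<close> the infimum below is over a bounded set of reals.\<close>

definition growth_condition :: "('n::finite) hamiltonian \<Rightarrow> bool" where
  "growth_condition H \<longleftrightarrow>
     (\<exists>K>0. \<forall>x p t. norm p \<ge> K \<longrightarrow>
        (H_p H x p t \<bullet> p - H x p t + (INF (y, s). H y 0 s)) * K - norm (H_x H x p t) \<ge> 0)"

section \<open>Time-periodic solutions of the viscous Hamilton--Jacobi equation\<close>

text \<open>Classical solutions: \<open>\<phi>\<close> is of class \<open>C\<^sup>1\<close> in \<open>t\<close> and of class \<open>C\<^sup>2\<close> in \<open>x\<close>, with
  \<open>\<phi>\<close>, \<open>\<phi>\<^sub>t\<close>, \<open>D\<phi>\<close> and \<open>D\<^sup>2\<phi>\<close> jointly continuous in \<open>(x, t)\<close>.\<close>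

definition C_2_1 :: "(real^'n::finite \<Rightarrow> real \<Rightarrow> real) \<Rightarrow> bool" where
  "C_2_1 \<phi> \<longleftrightarrow>
     (\<forall>x t. \<phi> x differentiable (at t)) \<and>
     (\<forall>x t. (\<lambda>y. \<phi> y t) differentiable (at x)) \<and>
     (\<forall>x t. grad (\<lambda>y. \<phi> y t) differentiable (at x)) \<and>
     continuous_on UNIV (\<lambda>(x, t). \<phi> x t) \<and>
     continuous_on UNIV (\<lambda>(x, t). deriv (\<phi> x) t) \<and>
     continuous_on UNIV (\<lambda>(x, t). grad (\<lambda>y. \<phi> y t) x) \<and>
     continuous_on UNIV (\<lambda>(x, t). hessian (\<lambda>y. \<phi> y t) x)"

definition time_periodic_solution ::
  "('n::finite) hamiltonian \<Rightarrow> real \<Rightarrow> real \<Rightarrow> (real^'n \<Rightarrow> real \<Rightarrow> real) \<Rightarrow> bool" where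
  "time_periodic_solution H \<epsilon> c \<phi> \<longleftrightarrow>
     C_2_1 \<phi> \<and> torus_periodic \<phi> \<and> (\<forall>x t. \<phi> x (t + 1) = \<phi> x t) \<and>
     (\<forall>x t. deriv (\<phi> x) t + \<epsilon> * laplacian (\<lambda>y. \<phi> y t) x + H x (grad (\<lambda>y. \<phi> y t) x) t = c)"

end

theory Submission
  imports Defs
begin

text \<open>
  With \<open>L = \<partial>\<^sub>t + \<epsilon>\<Delta> + H\<^sub>p\<cdot>D\<close>, formally \<open>L\<phi> = H\<^sub>p\<cdot>D\<phi> - H + c\<close> and \<open>L|D\<phi>| \<ge> - |H\<^sub>x|\<close>, while
  \<open>c \<ge> inf H(x,0,t)\<close> by evaluating the equation at a minimum of \<open>\<phi>\<close>.  So the growth condition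
  gives \<open>L(|D\<phi>| + K\<phi>) \<ge> 0\<close> wherever \<open>|D\<phi>| \<ge> K\<close>, and the maximum principle yields
  \<open>|D\<phi>| \<le> K + (K + 1)(max \<phi> - \<phi>)\<close>.  This is a Harnack inequality for \<open>max \<phi> - \<phi> + 1\<close> at the time
  at which \<open>\<phi>\<close> attains its maximum.  As the spatial minimum of \<open>\<phi>\<close> drops at a bounded rate backwards in
  time, the oscillation of \<open>\<phi>\<close>, and with it \<open>D\<phi>\<close>, is bounded independently of \<open>\<epsilon>\<close>.

  Comparing \<open>\<phi>(x + r e) - \<phi>(x)\<close> with a concave function of \<open>r\<close> shows that \<open>\<epsilon>|D\<phi>|\<close> is bounded, too.
  Finally, \<open>L(\<plusminus>\<phi>\<^sub>t + \<mu>|D\<phi>|\<^sup>2/2) = \<mu>\<epsilon>|D\<^sup>2\<phi>|\<^sup>2 - \<mu> H\<^sub>x\<cdot>D\<phi> \<mp> H\<^sub>t\<close> with \<open>\<mu> = 1 + \<epsilon>\<close> bounds \<open>\<epsilon>\<Delta>\<phi>\<close>, hence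
  \<open>\<phi>\<^sub>t\<close> by the equation, at the maximum of this function.
\<close>

section \<open>Jets and the maximum principle\<close>

lemma C_k_continuous_on: "C_k k f \<Longrightarrow> continuous_on UNIV f"
  by (cases k) (auto intro: continuous_at_imp_continuous_on differentiable_imp_continuous_within)

text \<open>If \<open>D\<close> were positive, \<open>f'\<close>, which vanishes at 0, would be
  positive just to the right of 0, and the mean value theorem would lift \<open>f\<close> above its
  maximum.\<close>

lemma second_derivative_at_max:
  fixes f f' :: "real \<Rightarrow> real"
  assumes f: "\<And>r. (f has_real_derivative f' r) (at r)"
    and f': "(f' has_real_derivative D) (at 0)"
    and max: "\<And>r. \<bar>r\<bar> < d \<Longrightarrow> f r \<le> f 0" and "d > 0"
  shows "f' 0 = 0" "D \<le> 0"
proof -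
  show z: "f' 0 = 0"
    using DERIV_local_max[OF f \<open>d > 0\<close>] max by auto
  show "D \<le> 0"
  proof (rule ccontr)
    assume "\<not> D \<le> 0"
    then obtain a where a: "a > 0" "\<And>r. 0 < r \<Longrightarrow> r < a \<Longrightarrow> f' 0 < f' (0 + r)"
      using DERIV_pos_inc_right[OF f'] by auto
    define b where "b = min a d / 2"
    have b: "0 < b" "b < a" "b < d" using a \<open>d > 0\<close> by (auto simp: b_def)
    obtain r where r: "0 < r" "r < b" "f b - f 0 = (b - 0) * f' r"
      using MVT2[of 0 b f f'] b f by auto
    have "f' r > 0" using a(2)[of r] r b z by simp
    then have "f b > f 0" using r b by (simp add: algebra_simps)
    then show False using max[of b] b by auto
  qed
qed

text \<open>Only derivatives along coordinate lines are recorded; they suffice for the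
  maximum principle and are stable under translations, sums and products.\<close>

definition jet ::
  "(real^'n \<Rightarrow> real \<Rightarrow> real) \<Rightarrow> (real^'n \<Rightarrow> real \<Rightarrow> real) \<Rightarrow>
   ('n::finite \<Rightarrow> real^'n \<Rightarrow> real \<Rightarrow> real) \<Rightarrow> ('n \<Rightarrow> real^'n \<Rightarrow> real \<Rightarrow> real) \<Rightarrow> bool" where
  "jet u ut ux uxx \<longleftrightarrow> (\<forall>x t. (u x has_real_derivative ut x t) (at t) \<and>
     (\<forall>i. ((\<lambda>r. u (x + r *\<^sub>R axis i 1) t) has_real_derivative ux i x t) (at 0) \<and>
          ((\<lambda>r. ux i (x + r *\<^sub>R axis i 1) t) has_real_derivative uxx i x t) (at 0)))"

lemma jetD:
  assumes "jet u ut ux uxx"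
  shows "(u x has_real_derivative ut x t) (at t)"
    "((\<lambda>r. u (x + r *\<^sub>R axis i 1) t) has_real_derivative ux i x t) (at 0)"
    "((\<lambda>r. ux i (x + r *\<^sub>R axis i 1) t) has_real_derivative uxx i x t) (at 0)"
  using assms by (auto simp: jet_def)

text \<open>The pair \<open>(e, s)\<close> is a direction in space-time. A derivative at parameter 0
  for all base points is one at every parameter, as moving along the line only shifts the base
  point.\<close>

lemma has_real_derivative_along_line:
  fixes u v :: "real^'n::finite \<Rightarrow> real \<Rightarrow> real"
  assumes "\<And>x t. ((\<lambda>r. u (x + r *\<^sub>R e) (t + r * s)) has_real_derivative v x t) (at 0)"
  shows "((\<lambda>r. u (x + r *\<^sub>R e) (t + r * s)) has_real_derivative v (x + r *\<^sub>R e) (t + r * s)) (at r)"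
proof -
  have "(\<lambda>q. u (x + (q + r) *\<^sub>R e) (t + (q + r) * s)) =
        (\<lambda>q. u (x + r *\<^sub>R e + q *\<^sub>R e) (t + r * s + q * s))"
    by (simp add: algebra_simps)
  then show ?thesis
    using assms[of "x + r *\<^sub>R e" "t + r * s"]
      DERIV_shift[of "\<lambda>r. u (x + r *\<^sub>R e) (t + r * s)" "v (x + r *\<^sub>R e) (t + r * s)" 0 r]
    by simp
qed

lemma jet_line:
  assumes "jet u ut ux uxx"
  shows "((\<lambda>r. u (x + r *\<^sub>R axis i 1) t) has_real_derivative ux i (x + r *\<^sub>R axis i 1) t) (at r)"
  using has_real_derivative_along_line[of u "axis i 1" 0 "ux i" x t r] jetD(2)[OF assms] by simp

lemma jet_at_space_max:
  assumes "jet u ut ux uxx" and "\<And>y. u y t \<le> u x t"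
  shows "ux i x t = 0" "uxx i x t \<le> 0"
  using second_derivative_at_max[of "\<lambda>r. u (x + r *\<^sub>R axis i 1) t" "\<lambda>r. ux i (x + r *\<^sub>R axis i 1) t" "uxx i x t" 1,
      OF jet_line[OF assms(1)] jetD(3)[OF assms(1)]] assms(2) by auto

lemma jet_at_max:
  assumes "jet u ut ux uxx" and "\<And>y s. u y s \<le> u x t"
  shows "ut x t = 0" "ux i x t = 0" "uxx i x t \<le> 0"
  using jet_at_space_max[OF assms(1), of t x i] assms(2)
    DERIV_local_max[OF jetD(1)[OF assms(1), of x t], of 1] by auto

lemma jet_add:
  assumes "jet u ut ux uxx" "jet v vt vx vxx"
  shows "jet (\<lambda>x t. u x t + v x t) (\<lambda>x t. ut x t + vt x t)
    (\<lambda>i x t. ux i x t + vx i x t) (\<lambda>i x t. uxx i x t + vxx i x t)"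
  using assms unfolding jet_def by (auto intro!: DERIV_add)

lemma jet_cmult:
  assumes "jet u ut ux uxx"
  shows "jet (\<lambda>x t. a * u x t) (\<lambda>x t. a * ut x t) (\<lambda>i x t. a * ux i x t) (\<lambda>i x t. a * uxx i x t)"
  using assms unfolding jet_def by (auto intro!: DERIV_cmult)

lemma jet_const: "jet (\<lambda>x t. a) (\<lambda>x t. 0) (\<lambda>i x t. 0) (\<lambda>i x t. 0)"
  unfolding jet_def by auto

lemma jet_sum:
  assumes "finite A" "\<And>j. j \<in> A \<Longrightarrow> jet (u j) (ut j) (ux j) (uxx j)"
  shows "jet (\<lambda>x t. \<Sum>j\<in>A. u j x t) (\<lambda>x t. \<Sum>j\<in>A. ut j x t)
    (\<lambda>i x t. \<Sum>j\<in>A. ux j i x t) (\<lambda>i x t. \<Sum>j\<in>A. uxx j i x t)"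
  using assms by (induction A rule: finite_induct) (auto intro: jet_const jet_add)

lemma jet_translate:
  assumes "jet u ut ux uxx"
  shows "jet (\<lambda>x t. u (x + y) (t + s)) (\<lambda>x t. ut (x + y) (t + s))
    (\<lambda>i x t. ux i (x + y) (t + s)) (\<lambda>i x t. uxx i (x + y) (t + s))"
proof -
  have shift: "x + r *\<^sub>R axis i 1 + y = (x + y) + r *\<^sub>R axis i 1" for x r i
    by (simp add: algebra_simps)
  show ?thesis
    unfolding jet_def shift using jetD[OF assms] by (auto simp: DERIV_shift[of "u _", symmetric])
qed

lemma jet_compose:
  assumes "jet u ut ux uxx"
    and G: "\<And>r. (G has_real_derivative G' r) (at r)" and G': "\<And>r. (G' has_real_derivative G'' r) (at r)"
  shows "jet (\<lambda>x t. G (u x t)) (\<lambda>x t. G' (u x t) * ut x t) (\<lambda>i x t. G' (u x t) * ux i x t)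
    (\<lambda>i x t. G'' (u x t) * (ux i x t)\<^sup>2 + G' (u x t) * uxx i x t)"
  unfolding jet_def
proof (intro allI conjI)
  fix x t i
  show "((\<lambda>t. G (u x t)) has_real_derivative G' (u x t) * ut x t) (at t)"
    by (rule DERIV_chain2[OF G jetD(1)[OF assms(1)]])
  have line: "((\<lambda>r. u (x + r *\<^sub>R axis i 1) t) has_real_derivative ux i x t) (at 0)"
    by (rule jetD(2)[OF assms(1)])
  show "((\<lambda>r. G (u (x + r *\<^sub>R axis i 1) t)) has_real_derivative G' (u x t) * ux i x t) (at 0)"
    using DERIV_chain2[OF G line] by simp
  have "((\<lambda>r. G' (u (x + r *\<^sub>R axis i 1) t)) has_real_derivative G'' (u x t) * ux i x t) (at 0)"
    using DERIV_chain2[OF G' line] by simp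
  from DERIV_mult[OF this jetD(3)[OF assms(1), of i x t]]
  show "((\<lambda>r. G' (u (x + r *\<^sub>R axis i 1) t) * ux i (x + r *\<^sub>R axis i 1) t) has_real_derivative
      G'' (u x t) * (ux i x t)\<^sup>2 + G' (u x t) * uxx i x t) (at 0)"
    by (simp add: power2_eq_square mult_ac add.commute)
qed

section \<open>Functions periodic in space and time\<close>

definition periodic :: "(real^'n::finite \<Rightarrow> real \<Rightarrow> 'b) \<Rightarrow> bool" where
  "periodic u \<longleftrightarrow> torus_periodic u \<and> (\<forall>x t. u x (t + 1) = u x t)"

lemma shift_to_unit_cube:
  obtains z :: "real^'n::finite" where "\<And>i. z $ i \<in> \<int>" "x + z \<in> cbox 0 1"
proof
  let ?z = "(\<chi> i. - of_int \<lfloor>x $ i\<rfloor>) :: real^'n"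
  show "?z $ i \<in> \<int>" for i by simp
  show "x + ?z \<in> cbox 0 1"
    by (auto simp: mem_box_cart) (metis add.commute of_int_floor_le real_of_int_floor_add_one_ge le_diff_eq diff_le_eq  of_int_floor_le)+
qed

lemma periodic_shift_int:
  assumes "\<And>t :: real. f (t + 1) = f t"
  shows "f (t + of_int k) = f t"
proof -
  have nat: "f (t + of_nat n) = f t" for t n
  proof (induction n)
    case (Suc n)
    then show ?case using assms[of "t + of_nat n"] by (simp add: algebra_simps)
  qed simp
  show ?thesis
  proof (cases k)
    case (nonneg n) then show ?thesis using nat by simp
  next
    case (neg n)
    then show ?thesis using nat[of "t + of_int k" "Suc n"] by simp
  qed
qed

lemma periodic_reduce:
  assumes "periodic u"
  obtains y s where "y \<in> cbox 0 1" "s \<in> {0..1}" "u y s = u x t"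
proof -
  obtain z where z: "\<And>i. z $ i \<in> \<int>" "x + z \<in> cbox 0 1" using shift_to_unit_cube[of x] by blast
  have "u (x + z) (frac t) = u (x + z) (frac t + of_int \<lfloor>t\<rfloor>)"
    using assms periodic_shift_int[of "u (x + z)" "frac t" "\<lfloor>t\<rfloor>"] by (simp add: periodic_def)
  also have "\<dots> = u x t"
    using assms z by (simp add: periodic_def torus_periodic_def frac_def)
  finally show ?thesis using that[of "x + z" "frac t"] z frac_lt_1[of t] by simp
qed

lemma periodic_attains_max:
  fixes u :: "real^'n::finite \<Rightarrow> real \<Rightarrow> real"
  assumes "periodic u" "continuous_on UNIV (\<lambda>(x, t). u x t)"
  obtains x t where "x \<in> cbox 0 1" "t \<in> {0..1}" "\<And>y s. u y s \<le> u x t"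
proof -
  let ?S = "cbox (0::real^'n) 1 \<times> {0..1::real}"
  have "(0, 0) \<in> ?S" by (auto simp: mem_box_cart)
  then have "?S \<noteq> {}" by blast
  moreover have "compact ?S" by (intro compact_Times) auto
  moreover have "continuous_on ?S (\<lambda>(x, t). u x t)"
    using assms(2) by (rule continuous_on_subset) simp
  ultimately obtain z where z: "z \<in> ?S" "\<And>w. w \<in> ?S \<Longrightarrow> (\<lambda>(x, t). u x t) w \<le> (\<lambda>(x, t). u x t) z"
    using continuous_attains_sup[of ?S "\<lambda>(x, t). u x t"] by blast
  obtain x t where xt: "z = (x, t)" by (cases z)
  have "u y s \<le> u x t" for y s
  proof -
    obtain y' s' where "y' \<in> cbox 0 1" "s' \<in> {0..1}" "u y' s' = u y s"
      by (rule periodic_reduce[OF assms(1)])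
    then show ?thesis using z(2)[of "(y', s')"] xt by auto
  qed
  then show ?thesis using that z(1) xt by auto
qed

section \<open>Limits of difference quotients at moving base points\<close>

text \<open>The mean value theorem on the segment from \<open>a n\<close> to \<open>b n\<close>
  yields an intermediate point squeezed to \<open>z\<close>. The direction may vary with
  \<open>n\<close> as well: for \<open>H\<close> along the graph of D\<phi> the increment of the
  momentum is controlled only in the limit.\<close>

lemma mvt_quotient_limit:
  fixes f :: "'a::real_normed_vector \<Rightarrow> real"
  assumes f: "\<And>z. (f has_derivative f' z) (at z)"
    and f': "\<And>Z V z v. Z \<longlonglongrightarrow> z \<Longrightarrow> V \<longlonglongrightarrow> v \<Longrightarrow> (\<lambda>n. f' (Z n) (V n)) \<longlonglongrightarrow> f' z v"
    and a: "a \<longlonglongrightarrow> z" and b: "b \<longlonglongrightarrow> z" and v: "(\<lambda>n. (b n - a n) /\<^sub>R h n) \<longlonglongrightarrow> v"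
  shows "(\<lambda>n. (f (b n) - f (a n)) / h n) \<longlonglongrightarrow> f' z v"
proof -
  have "\<exists>r\<in>{0<..<1}. f (b n) - f (a n) = f' (a n + r *\<^sub>R (b n - a n)) (b n - a n)" for n
  proof -
    have "((\<lambda>r. f (a n + r *\<^sub>R (b n - a n))) has_derivative
            (\<lambda>q. f' (a n + r *\<^sub>R (b n - a n)) (q *\<^sub>R (b n - a n)))) (at r)" for r
      by (rule has_derivative_compose[OF _ f]) (auto intro!: derivative_eq_intros)
    then have "((\<lambda>r. f (a n + r *\<^sub>R (b n - a n))) has_derivative
            (\<lambda>q. f' (a n + r *\<^sub>R (b n - a n)) (q *\<^sub>R (b n - a n)))) (at r within {0..1})" for r
      by (rule has_derivative_at_withinI)
    from mvt_simple[OF _ this] show ?thesis by fastforce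
  qed
  then obtain r where r: "\<And>n. r n \<in> {0<..<1}"
      "\<And>n. f (b n) - f (a n) = f' (a n + r n *\<^sub>R (b n - a n)) (b n - a n)"
    by metis
  have "(\<lambda>n. r n *\<^sub>R (b n - a n)) \<longlonglongrightarrow> 0"
  proof (rule Lim_null_comparison)
    show "\<forall>\<^sub>F n in sequentially. norm (r n *\<^sub>R (b n - a n)) \<le> norm (b n - a n)"
      using r(1) by (intro always_eventually allI) (auto intro!: mult_left_le_one_le simp: less_imp_le abs_of_pos)
    show "(\<lambda>n. norm (b n - a n)) \<longlonglongrightarrow> 0"
      using tendsto_norm[OF tendsto_diff[OF b a]] by simp
  qed
  then have "(\<lambda>n. a n + r n *\<^sub>R (b n - a n)) \<longlonglongrightarrow> z"
    using tendsto_add[OF a] by fastforce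
  from f'[OF this v]
  have "(\<lambda>n. f' (a n + r n *\<^sub>R (b n - a n)) ((b n - a n) /\<^sub>R h n)) \<longlonglongrightarrow> f' z v" .
  moreover have "f' (a n + r n *\<^sub>R (b n - a n)) ((b n - a n) /\<^sub>R h n) = (f (b n) - f (a n)) / h n" for n
    using linear_scale[OF has_derivative_linear[OF f]] r(2) by (simp add: divide_inverse mult.commute)
  ultimately show ?thesis by simp
qed

text \<open>The same principle for one fixed space-time direction, so only continuity of that single
  directional derivative enters.\<close>

lemma difference_quotient_limit:
  fixes u v :: "real^'n::finite \<Rightarrow> real \<Rightarrow> real"
  assumes u: "\<And>x t. ((\<lambda>r. u (x + r *\<^sub>R e) (t + r * s)) has_real_derivative v x t) (at 0)"
    and v: "continuous_on UNIV (\<lambda>(x, t). v x t)"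
    and h: "h \<longlonglongrightarrow> 0" "\<And>n. h n > 0" and X: "X \<longlonglongrightarrow> x" and T: "T \<longlonglongrightarrow> t"
  shows "(\<lambda>n. (u (X n + h n *\<^sub>R e) (T n + h n * s) - u (X n) (T n)) / h n) \<longlonglongrightarrow> v x t"
proof -
  have "\<exists>r. 0 < r \<and> r < h n \<and> u (X n + h n *\<^sub>R e) (T n + h n * s) - u (X n) (T n) =
      h n * v (X n + r *\<^sub>R e) (T n + r * s)" for n
    using MVT2[of 0 "h n" "\<lambda>r. u (X n + r *\<^sub>R e) (T n + r * s)" "\<lambda>r. v (X n + r *\<^sub>R e) (T n + r * s)"]
      h(2)[of n] has_real_derivative_along_line[OF u] by auto
  then obtain r where r: "\<And>n. 0 < r n" "\<And>n. r n < h n"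
      "\<And>n. u (X n + h n *\<^sub>R e) (T n + h n * s) - u (X n) (T n) = h n * v (X n + r n *\<^sub>R e) (T n + r n * s)"
    by metis
  have "r \<longlonglongrightarrow> 0"
    by (rule Lim_null_comparison[OF _ h(1)]) (use r in \<open>auto intro!: always_eventually simp: less_imp_le abs_of_pos\<close>)
  then have "(\<lambda>n. (X n + r n *\<^sub>R e, T n + r n * s)) \<longlonglongrightarrow> (x + 0 *\<^sub>R e, t + 0 * s)"
    by (intro tendsto_intros X T)
  from continuous_on_tendsto_compose[OF v this]
  have "(\<lambda>n. v (X n + r n *\<^sub>R e) (T n + r n * s)) \<longlonglongrightarrow> v x t" by simp
  moreover have "(u (X n + h n *\<^sub>R e) (T n + h n * s) - u (X n) (T n)) / h n = v (X n + r n *\<^sub>R e) (T n + r n * s)" for n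
    using r(3)[of n] h(2)[of n] by simp
  ultimately show ?thesis by simp
qed

section \<open>Periodic Hamiltonians\<close>

lemma grad_inner:
  assumes "f differentiable (at x)"
  shows "grad f x \<bullet> v = frechet_derivative f (at x) v"
proof -
  have lin: "linear (frechet_derivative f (at x))"
    using assms frechet_derivative_works has_derivative_linear by blast
  have "frechet_derivative f (at x) v = frechet_derivative f (at x) (\<Sum>i\<in>UNIV. v $ i *\<^sub>R axis i 1)"
    by (simp add: basis_expansion flip: scalar_mult_eq_scaleR)
  also have "\<dots> = (\<Sum>i\<in>UNIV. v $ i * frechet_derivative f (at x) (axis i 1))"
    by (simp add: linear_sum[OF lin] linear_scale[OF lin])
  finally show ?thesis by (simp add: grad_def inner_vec_def mult.commute)
qed

lemma grad_has_derivative: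
  assumes "f differentiable (at x)"
  shows "(f has_derivative (\<lambda>v. grad f x \<bullet> v)) (at x)"
  using assms by (simp add: grad_inner frechet_derivative_works eta_contract_eq)

lemma grad_eqI:
  assumes "(f has_derivative f') (at x)"
  shows "grad f x \<bullet> v = f' v"
  using assms grad_inner[of f x v] frechet_derivative_at[OF assms] by (auto simp: differentiable_def)

locale periodic_hamiltonian =
  fixes H :: "('n::finite) hamiltonian"
  assumes C1: "C_k (Suc 0) (\<lambda>(x, p, t). H x p t)"
    and torus: "torus_periodic H"
    and time: "periodicity H"
begin

definition dH :: "(real^'n) \<times> (real^'n) \<times> real \<Rightarrow> (real^'n) \<times> (real^'n) \<times> real \<Rightarrow> real" where
  "dH z = frechet_derivative (\<lambda>(x, p, t). H x p t) (at z)"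

lemma H_has_derivative: "((\<lambda>(x, p, t). H x p t) has_derivative dH z) (at z)"
  using C1 unfolding dH_def C_k.simps frechet_derivative_works[symmetric] by blast

lemma linear_dH: "linear (dH z)"
  by (rule has_derivative_linear[OF H_has_derivative])

lemma dH_expand: "dH z v = (\<Sum>b\<in>Basis. (v \<bullet> b) * dH z b)"
  by (subst euclidean_representation[of v, symmetric])
     (simp only: linear_sum[OF linear_dH] linear_scale[OF linear_dH] real_scaleR_def)

lemma continuous_dH: "b \<in> Basis \<Longrightarrow> continuous_on UNIV (\<lambda>z. dH z b)"
  using C1 unfolding dH_def by simp

lemma continuous_H: "continuous_on UNIV (\<lambda>(x, p, t). H x p t)"
  using C_k_continuous_on[OF C1] .

lemma dH_tendsto:
  assumes "Z \<longlonglongrightarrow> z" "V \<longlonglongrightarrow> v"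
  shows "(\<lambda>n. dH (Z n) (V n)) \<longlonglongrightarrow> dH z v"
  unfolding dH_expand[of _ "V _"] dH_expand[of z v]
  by (intro tendsto_intros assms continuous_on_tendsto_compose[OF continuous_dH]) auto

lemma H_quotient_limit:
  fixes a b :: "nat \<Rightarrow> (real^'n) \<times> (real^'n) \<times> real"
  assumes "a \<longlonglongrightarrow> z" "b \<longlonglongrightarrow> z" "(\<lambda>n. (b n - a n) /\<^sub>R h n) \<longlonglongrightarrow> v"
  shows "(\<lambda>n. ((\<lambda>(x, p, t). H x p t) (b n) - (\<lambda>(x, p, t). H x p t) (a n)) / h n) \<longlonglongrightarrow> dH z v"
proof (rule mvt_quotient_limit[where f = "\<lambda>(x, p, t). H x p t" and f' = dH])
  show "((\<lambda>(x, p, t). H x p t) has_derivative dH w) (at w)" for w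
    by (rule H_has_derivative)
  show "(\<lambda>n. dH (Z n) (V n)) \<longlonglongrightarrow> dH w u" if "Z \<longlonglongrightarrow> w" "V \<longlonglongrightarrow> u" for Z V w u
    by (rule dH_tendsto[OF that])
qed (rule assms)+

lemma H_tendsto:
  assumes "X \<longlonglongrightarrow> x" "P \<longlonglongrightarrow> p" "T \<longlonglongrightarrow> t"
  shows "(\<lambda>n. H (X n) (P n) (T n)) \<longlonglongrightarrow> H x p t"
  using continuous_on_tendsto_compose[OF continuous_H, of "\<lambda>n. (X n, P n, T n)" "(x, p, t)" sequentially]
    assms by (simp add: tendsto_Pair)

lemma H_x_inner: "H_x H x p t \<bullet> e = dH (x, p, t) (e, 0, 0)"
proof -
  have "((\<lambda>y. (y, p, t)) has_derivative (\<lambda>v. (v, 0, 0))) (at x)"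
    by (auto intro!: derivative_eq_intros simp: zero_prod_def)
  from has_derivative_compose[OF this H_has_derivative]
  show ?thesis unfolding H_x_def by (simp add: grad_eqI)
qed

lemma H_p_inner: "H_p H x p t \<bullet> q = dH (x, p, t) (0, q, 0)"
proof -
  have "((\<lambda>y. (x, y, t)) has_derivative (\<lambda>v. (0, v, 0))) (at p)"
    by (auto intro!: derivative_eq_intros simp: zero_prod_def)
  from has_derivative_compose[OF this H_has_derivative]
  show ?thesis unfolding H_p_def by (simp add: grad_eqI)
qed

lemma dH_space_momentum: "dH (x, p, t) (e, q, 0) = H_x H x p t \<bullet> e + H_p H x p t \<bullet> q"
proof -
  have "(e, q, 0::real) = (e, 0, 0) + (0, q, 0)" by simp
  then show ?thesis
    by (simp only: linear_add[OF linear_dH] H_x_inner H_p_inner)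
qed

text \<open>One representative has to serve all momenta simultaneously; hence
  \<open>periodic_reduce\<close> is applied to the map from \<open>(x, t)\<close> to the function of
  \<open>p\<close>.\<close>

lemma H_reduce:
  obtains y s where "y \<in> cbox 0 1" "s \<in> {0..1}" "\<And>p. H y p s = H x p t"
proof -
  have "periodic (\<lambda>x t p. H x p t)"
    using torus time unfolding periodic_def torus_periodic_def periodicity_def by (auto simp: fun_eq_iff)
  then obtain y s where "y \<in> cbox 0 1" "s \<in> {0..1}" "(\<lambda>p. H y p s) = (\<lambda>p. H x p t)"
    by (rule periodic_reduce)
  then show ?thesis using that by (simp add: fun_eq_iff)
qed

lemma compact_phase: "compact (cbox (0::real^'n) 1 \<times> cball (0::real^'n) R \<times> {0..1::real})"
  by (intro compact_Times) auto

lemma H_bounded: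
  obtains C where "\<And>x p t. norm p \<le> R \<Longrightarrow> \<bar>H x p t\<bar> \<le> C"
proof -
  have "bounded ((\<lambda>(x, p, t). H x p t) ` (cbox 0 1 \<times> cball 0 R \<times> {0..1}))"
    by (intro compact_imp_bounded compact_continuous_image compact_phase continuous_on_subset[OF continuous_H]) simp
  then obtain C where C: "C > 0" "\<forall>y \<in> (\<lambda>(x, p, t). H x p t) ` (cbox 0 1 \<times> cball 0 R \<times> {0..1}). norm y \<le> C"
    unfolding bounded_pos by blast
  have "\<bar>H x p t\<bar> \<le> C" if "norm p \<le> R" for x p t
  proof -
    obtain y s where "y \<in> cbox 0 1" "s \<in> {0..1}" "\<And>p. H y p s = H x p t"
      using H_reduce[of x t] by blast
    moreover have "(y, p, s) \<in> cbox 0 1 \<times> cball 0 R \<times> {0..1}" using calculation that by auto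
    then have "norm (H y p s) \<le> C" using C(2) by (force simp del: mem_cball)
    ultimately show ?thesis by simp
  qed
  then show ?thesis by (rule that)
qed

text \<open>Restricting to the fundamental cell suffices because \<open>bernstein\<close> delivers
  its maximum points there.\<close>

lemma dH_bounded:
  obtains C where "C \<ge> 0"
    "\<And>x p t v. x \<in> cbox 0 1 \<Longrightarrow> norm p \<le> R \<Longrightarrow> t \<in> {0..1} \<Longrightarrow> \<bar>dH (x, p, t) v\<bar> \<le> C * norm v"
proof -
  \<comment> \<open>The sum of the absolute partial derivatives is continuous and dominates the
    operator norm of \<open>dH z\<close>.\<close>
  let ?f = "\<lambda>z. \<Sum>b\<in>Basis. \<bar>dH z b\<bar>"
  have "bounded (?f ` (cbox 0 1 \<times> cball 0 R \<times> {0..1}))"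
    by (intro compact_imp_bounded compact_continuous_image compact_phase continuous_intros
        continuous_on_subset[OF continuous_dH]) auto
  then obtain C where C: "C > 0" "\<forall>y \<in> ?f ` (cbox 0 1 \<times> cball 0 R \<times> {0..1}). norm y \<le> C"
    unfolding bounded_pos by blast
  have "\<bar>dH (x, p, t) v\<bar> \<le> C * norm v" if "x \<in> cbox 0 1" "norm p \<le> R" "t \<in> {0..1}" for x p t v
  proof -
    have "\<bar>dH (x, p, t) v\<bar> \<le> (\<Sum>b\<in>Basis. \<bar>(v \<bullet> b) * dH (x, p, t) b\<bar>)"
      by (subst dH_expand) (rule sum_abs)
    also have "\<dots> \<le> (\<Sum>b\<in>Basis. norm v * \<bar>dH (x, p, t) b\<bar>)"
      by (intro sum_mono) (auto simp: abs_mult intro!: mult_right_mono Basis_le_norm)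
    also have "\<dots> = ?f (x, p, t) * norm v" by (simp add: sum_distrib_left mult.commute)
    also have "\<dots> \<le> C * norm v"
    proof (rule mult_right_mono)
      have "(x, p, t) \<in> cbox 0 1 \<times> cball 0 R \<times> {0..1}" using that by auto
      then have "norm (?f (x, p, t)) \<le> C" using C(2) by blast
      then show "?f (x, p, t) \<le> C" by simp
    qed simp
    finally show ?thesis .
  qed
  then show ?thesis using that[of C] C(1) by simp
qed

text \<open>On the reals, \<open>INF\<close> is a lower bound only for sets bounded below;
  periodicity and compactness supply this.\<close>

lemma Inf_H_zero_le: "(INF (y, s). H y 0 s) \<le> H x 0 t"
proof -
  obtain C where C: "\<And>x p t. norm p \<le> 0 \<Longrightarrow> \<bar>H x p t\<bar> \<le> C"
    using H_bounded[of 0] by metis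
  have "- C \<le> H y 0 s" for y s
    using C[of 0 y s] by simp
  then have "bdd_below (range (\<lambda>(y, s). H y 0 s))"
    by (intro bdd_belowI[of _ "- C"]) auto
  from cINF_lower[OF this, of "(x, t)"] show ?thesis by simp
qed

end

section \<open>Bernstein's method for periodic solutions\<close>

text \<open>The linear part of the equation, read off from the entries of a jet. It is a backward
  heat operator; at a space-time maximum the direction of time is immaterial, but it is the reason
  why minima are followed backwards in \<open>min_propagates_backwards\<close>.\<close>

definition heat_op :: "real \<Rightarrow> (real^'n::finite \<Rightarrow> real \<Rightarrow> real) \<Rightarrow> ('n \<Rightarrow> real^'n \<Rightarrow> real \<Rightarrow> real) \<Rightarrow>
    real^'n \<Rightarrow> real \<Rightarrow> real" where
  "heat_op \<epsilon> ut uxx x t = ut x t + \<epsilon> * (\<Sum>i\<in>UNIV. uxx i x t)"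

locale periodic_solution = periodic_hamiltonian H for H :: "('n::finite) hamiltonian" +
  fixes \<epsilon> c :: real and \<phi> :: "real^'n \<Rightarrow> real \<Rightarrow> real"
  assumes \<epsilon>: "\<epsilon> > 0" and sol: "time_periodic_solution H \<epsilon> c \<phi>"
begin

definition \<phi>t :: "real^'n \<Rightarrow> real \<Rightarrow> real" where "\<phi>t x t = deriv (\<phi> x) t"
definition D\<phi> :: "real^'n \<Rightarrow> real \<Rightarrow> real^'n" where "D\<phi> x t = grad (\<lambda>y. \<phi> y t) x"
definition D2\<phi> :: "real^'n \<Rightarrow> real \<Rightarrow> real^'n^'n" where "D2\<phi> x t = hessian (\<lambda>y. \<phi> y t) x"

lemma C21: "C_2_1 \<phi>" using sol by (simp add: time_periodic_solution_def)

lemma continuous_\<phi>: "continuous_on UNIV (\<lambda>(x, t). \<phi> x t)"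
  and continuous_\<phi>t: "continuous_on UNIV (\<lambda>(x, t). \<phi>t x t)"
  and continuous_D\<phi>: "continuous_on UNIV (\<lambda>(x, t). D\<phi> x t)"
  and continuous_D2\<phi>: "continuous_on UNIV (\<lambda>(x, t). D2\<phi> x t)"
  using C21 by (auto simp: C_2_1_def \<phi>t_def D\<phi>_def D2\<phi>_def)

lemma \<phi>_tendsto: "X \<longlonglongrightarrow> x \<Longrightarrow> T \<longlonglongrightarrow> t \<Longrightarrow> (\<lambda>n. \<phi> (X n) (T n)) \<longlonglongrightarrow> \<phi> x t"
  and D\<phi>_tendsto: "X \<longlonglongrightarrow> x \<Longrightarrow> T \<longlonglongrightarrow> t \<Longrightarrow> (\<lambda>n. D\<phi> (X n) (T n)) \<longlonglongrightarrow> D\<phi> x t"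
  using continuous_on_tendsto_compose[OF continuous_\<phi>, of "\<lambda>n. (X n, T n)" "(x, t)" sequentially]
    continuous_on_tendsto_compose[OF continuous_D\<phi>, of "\<lambda>n. (X n, T n)" "(x, t)" sequentially]
  by (auto simp: tendsto_Pair)

lemma periodic_\<phi>: "periodic \<phi>"
  using sol by (simp add: time_periodic_solution_def periodic_def)

lemma \<phi>_has_derivative: "((\<lambda>y. \<phi> y t) has_derivative (\<lambda>v. D\<phi> x t \<bullet> v)) (at x)"
  using C21 unfolding C_2_1_def D\<phi>_def by (intro grad_has_derivative) auto

lemma D\<phi>_has_derivative: "((\<lambda>y. D\<phi> y t) has_derivative (\<lambda>v. D2\<phi> x t *v v)) (at x)"
  using C21 jacobian_works[of "grad (\<lambda>y. \<phi> y t)" "at x"]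
  unfolding C_2_1_def D\<phi>_def D2\<phi>_def hessian_def by auto

lemma \<phi>_line: "((\<lambda>r. \<phi> (x + r *\<^sub>R e) t) has_real_derivative D\<phi> (x + r *\<^sub>R e) t \<bullet> e) (at r)"
proof -
  have "((\<lambda>r. x + r *\<^sub>R e) has_derivative (\<lambda>q. q *\<^sub>R e)) (at r)"
    by (auto intro!: derivative_eq_intros)
  from has_derivative_compose[OF this \<phi>_has_derivative]
  show ?thesis by (simp add: has_field_derivative_def mult_commute_abs)
qed

lemma D\<phi>_line:
  "((\<lambda>r. D\<phi> (x + r *\<^sub>R axis i 1) t $ j) has_real_derivative D2\<phi> (x + r *\<^sub>R axis i 1) t $ j $ i) (at r)"
proof -
  have "((\<lambda>r. x + r *\<^sub>R axis i 1) has_derivative (\<lambda>q. q *\<^sub>R axis i 1)) (at r)"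
    by (auto intro!: derivative_eq_intros)
  from has_derivative_compose[OF this D\<phi>_has_derivative]
  have "((\<lambda>r. D\<phi> (x + r *\<^sub>R axis i 1) t) has_derivative
      (\<lambda>q. D2\<phi> (x + r *\<^sub>R axis i 1) t *v (q *\<^sub>R axis i 1))) (at r)" .
  from bounded_linear.has_derivative[OF bounded_linear_vec_nth[of j] this]
  show ?thesis
    by (simp add: has_field_derivative_def mult_commute_abs matrix_vector_mult_scaleR
        matrix_vector_mult_basis column_def)
qed

lemma jet_\<phi>: "jet \<phi> \<phi>t (\<lambda>i x t. D\<phi> x t $ i) (\<lambda>i x t. D2\<phi> x t $ i $ i)"
proof -
  have "(\<phi> x has_real_derivative \<phi>t x t) (at t)" for x t
    using C21 by (auto simp: C_2_1_def \<phi>t_def DERIV_deriv_iff_real_differentiable)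
  then show ?thesis
    using \<phi>_line[of _ "axis _ 1" _ 0] D\<phi>_line[of _ _ _ _ 0]
    by (simp add: jet_def inner_axis)
qed

lemma heat_op_\<phi>: "heat_op \<epsilon> \<phi>t (\<lambda>i x t. D2\<phi> x t $ i $ i) x t = c - H x (D\<phi> x t) t"
  using sol by (simp add: time_periodic_solution_def heat_op_def \<phi>t_def D\<phi>_def D2\<phi>_def
      laplacian_def trace_def algebra_simps)

end

lemma heat_op_at_max:
  assumes "jet u ut ux uxx" "\<And>y s. u y s \<le> u x t" "\<epsilon> > 0"
  shows "heat_op \<epsilon> ut uxx x t \<le> 0"
  using jet_at_max[OF assms(1,2)] assms(3)
  by (auto simp: heat_op_def intro!: mult_nonneg_nonpos sum_nonpos)

lemma periodic_translate:
  fixes u :: "real^'n::finite \<Rightarrow> real \<Rightarrow> 'b"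
  assumes "periodic u"
  shows "periodic (\<lambda>x t. u (x + y) (t + s))"
proof -
  have "x + z + y = x + y + z" "t + 1 + s = t + s + 1" for x z :: "real^'n" and t
    by simp_all
  then show ?thesis using assms by (simp only: periodic_def torus_periodic_def) auto
qed

lemma periodic_combine:
  assumes "periodic u" "periodic v"
  shows "periodic (\<lambda>x t. f (u x t) (v x t))"
  using assms by (simp add: periodic_def torus_periodic_def)

context periodic_solution
begin

text \<open>Bernstein's method without differentiating the equation, for which \<open>\<phi>\<close> is not smooth
  enough: a space-time difference quotient of \<open>\<phi>\<close> plus a lower order correction \<open>N\<close>
  is maximised, and the step size tends to zero only at the maximum points.\<close>

lemma bernstein:
  fixes e :: "real^'n" and s :: real and N :: "real \<Rightarrow> real^'n \<Rightarrow> real \<Rightarrow> real"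
  assumes v: "\<And>x t. ((\<lambda>r. \<phi> (x + r *\<^sub>R e) (t + r * s)) has_real_derivative v x t) (at 0)"
    and cont_v: "continuous_on UNIV (\<lambda>(x, t). v x t)"
    and N_jet: "\<And>h. h > 0 \<Longrightarrow> jet (N h) (Nt h) (Nx h) (Nxx h)"
    and N_cont: "\<And>h. h > 0 \<Longrightarrow> continuous_on UNIV (\<lambda>(x, t). N h x t)"
    and N_per: "\<And>h. h > 0 \<Longrightarrow> periodic (N h)"
    and N_lim: "\<And>\<eta> X T x t. \<eta> \<longlonglongrightarrow> 0 \<Longrightarrow> (\<And>n. \<eta> n > 0) \<Longrightarrow> X \<longlonglongrightarrow> x \<Longrightarrow> T \<longlonglongrightarrow> t \<Longrightarrow>
      (\<lambda>n::nat. N (\<eta> n) (X n) (T n)) \<longlonglongrightarrow> L x t"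
    and Nx_lim: "\<And>\<eta> X T x t i. \<eta> \<longlonglongrightarrow> 0 \<Longrightarrow> (\<And>n. \<eta> n > 0) \<Longrightarrow> X \<longlonglongrightarrow> x \<Longrightarrow> T \<longlonglongrightarrow> t \<Longrightarrow>
      (\<lambda>n::nat. Nx (\<eta> n) i (X n) (T n)) \<longlonglongrightarrow> Lx x t $ i"
    and N_heat_lim: "\<And>\<eta> X T x t. \<eta> \<longlonglongrightarrow> 0 \<Longrightarrow> (\<And>n. \<eta> n > 0) \<Longrightarrow> X \<longlonglongrightarrow> x \<Longrightarrow> T \<longlonglongrightarrow> t \<Longrightarrow>
      (\<lambda>n::nat. heat_op \<epsilon> (Nt (\<eta> n)) (Nxx (\<eta> n)) (X n) (T n)) \<longlonglongrightarrow> LP x t"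
  obtains x t where "x \<in> cbox 0 1" "t \<in> {0..1}" "\<And>y s. v y s + L y s \<le> v x t + L x t"
    "LP x t \<le> dH (x, D\<phi> x t, t) (e, - Lx x t, s)"
proof -
  define W where "W h x t = 1 / h * (\<phi> (x + h *\<^sub>R e) (t + h * s) + - 1 * \<phi> x t) + N h x t" for h x t
  define H' where "H' h x t = H (x + h *\<^sub>R e) (D\<phi> (x + h *\<^sub>R e) (t + h * s)) (t + h * s)" for h x t
  \<comment> \<open>All that is kept of a maximum of \<open>W h\<close>: its location, maximality,
    the first order condition, and the second order condition with the equation inserted.\<close>
  define good where "good h z \<longleftrightarrow> fst z \<in> cbox 0 1 \<and> snd z \<in> {0..1} \<and> (\<forall>y s. W h y s \<le> W h (fst z) (snd z)) \<and>
      (\<forall>i. (D\<phi> (fst z + h *\<^sub>R e) (snd z + h * s) $ i - D\<phi> (fst z) (snd z) $ i) / h = - Nx h i (fst z) (snd z)) \<and>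
      heat_op \<epsilon> (Nt h) (Nxx h) (fst z) (snd z) \<le>
        (H' h (fst z) (snd z) - H (fst z) (D\<phi> (fst z) (snd z)) (snd z)) / h" for h z
  have "\<exists>z. good h z" if h: "h > 0" for h
  proof -
    have jet_W: "jet (W h)
      (\<lambda>x t. 1 / h * (\<phi>t (x + h *\<^sub>R e) (t + h * s) + - 1 * \<phi>t x t) + Nt h x t)
      (\<lambda>i x t. 1 / h * (D\<phi> (x + h *\<^sub>R e) (t + h * s) $ i + - 1 * D\<phi> x t $ i) + Nx h i x t)
      (\<lambda>i x t. 1 / h * (D2\<phi> (x + h *\<^sub>R e) (t + h * s) $ i $ i + - 1 * D2\<phi> x t $ i $ i) + Nxx h i x t)"
      unfolding W_def
      using jet_add[OF jet_cmult[OF jet_add[OF jet_translate[OF jet_\<phi>, of "h *\<^sub>R e" "h * s"]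
            jet_cmult[OF jet_\<phi>, of "- 1"]], of "1 / h"] N_jet[OF h]] .
    have "continuous_on UNIV (\<lambda>z. \<phi> (fst z + h *\<^sub>R e) (snd z + h * s))"
      using continuous_on_compose2[OF continuous_\<phi>, of UNIV "\<lambda>z. (fst z + h *\<^sub>R e, snd z + h * s)"]
      by (simp add: continuous_intros)
    then have cont: "continuous_on UNIV (\<lambda>(x, t). W h x t)"
      using continuous_\<phi> N_cont[OF h] unfolding W_def case_prod_beta by (intro continuous_intros) auto
    have per: "periodic (W h)"
      unfolding W_def
      by (rule periodic_combine[where f = "\<lambda>a b. a + b", OF
            periodic_combine[where f = "\<lambda>a b. 1 / h * (a + - 1 * b)", OF periodic_translate[OF periodic_\<phi>] periodic_\<phi>]
            N_per[OF h]])
    obtain x t where xt: "x \<in> cbox 0 1" "t \<in> {0..1}" and max: "\<And>y s. W h y s \<le> W h x t"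
      using periodic_attains_max[OF per cont] by blast
    \<comment> \<open>First order condition: at the maximum the difference quotient of D\<phi> is
      exactly minus the gradient of the correction.\<close>
    have "(D\<phi> (x + h *\<^sub>R e) (t + h * s) $ i - D\<phi> x t $ i) / h = - Nx h i x t" for i
      using jet_at_max(2)[OF jet_W max, of i] by (simp add: divide_inverse mult.commute)
    moreover have "heat_op \<epsilon> (Nt h) (Nxx h) x t \<le> (H' h x t - H x (D\<phi> x t) t) / h"
    proof -
      \<comment> \<open>Subtracting the equation at the two ends of the quotient replaces the heat
        operator of \<phi> by a difference quotient of \<open>H\<close>; the constant
        \<open>c\<close> cancels.\<close>
      have "heat_op \<epsilon> \<phi>t (\<lambda>i x t. D2\<phi> x t $ i $ i) (x + h *\<^sub>R e) (t + h * s) / h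
          - heat_op \<epsilon> \<phi>t (\<lambda>i x t. D2\<phi> x t $ i $ i) x t / h + heat_op \<epsilon> (Nt h) (Nxx h) x t \<le> 0"
        using heat_op_at_max[OF jet_W max \<epsilon>] h
        by (simp add: heat_op_def sum.distrib sum_subtractf field_simps flip: sum_divide_distrib sum_distrib_left)
      then show ?thesis by (simp add: heat_op_\<phi> diff_divide_distrib H'_def)
    qed
    ultimately show ?thesis using xt max unfolding good_def by (intro exI[of _ "(x, t)"]) auto
  qed
  then have "\<forall>h. \<exists>z. h > 0 \<longrightarrow> good h z" by blast
  from choice[OF this] obtain Z where Z: "\<And>h. h > 0 \<Longrightarrow> good h (Z h)" by blast
  define X where "X h = fst (Z h)" for h
  define T where "T h = snd (Z h)" for h
  have XT: "X h \<in> cbox 0 1" "T h \<in> {0..1}" "W h y r \<le> W h (X h) (T h)"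
    "(D\<phi> (X h + h *\<^sub>R e) (T h + h * s) $ i - D\<phi> (X h) (T h) $ i) / h = - Nx h i (X h) (T h)"
    "heat_op \<epsilon> (Nt h) (Nxx h) (X h) (T h) \<le> (H' h (X h) (T h) - H (X h) (D\<phi> (X h) (T h)) (T h)) / h"
    if "h > 0" for h y r i
    using Z[OF that] unfolding good_def X_def T_def by auto
  \<comment> \<open>The maximum points stay in a compact cell, so along a subsequence of these step
    sizes they converge.\<close>
  define \<eta>0 :: "nat \<Rightarrow> real" where "\<eta>0 n = inverse (real (Suc n))" for n
  have "compact (cbox (0::real^'n) 1 \<times> {0..1::real})" by (intro compact_Times) auto
  moreover have "\<forall>n. (X (\<eta>0 n), T (\<eta>0 n)) \<in> cbox 0 1 \<times> {0..1}"
    using XT(1,2) by (simp add: \<eta>0_def)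
  ultimately obtain l k where l: "l \<in> cbox (0::real^'n) 1 \<times> {0..1::real}" and k: "strict_mono k"
      and "((\<lambda>n. (X (\<eta>0 n), T (\<eta>0 n))) \<circ> k) \<longlonglongrightarrow> l"
    using seq_compactE[OF compact_imp_seq_compact, of _ "\<lambda>n. (X (\<eta>0 n), T (\<eta>0 n))"] by blast
  then obtain x t where xt: "x \<in> cbox 0 1" "t \<in> {0..1}" and
    lim: "(\<lambda>n. (X (\<eta>0 (k n)), T (\<eta>0 (k n)))) \<longlonglongrightarrow> (x, t)"
    by (cases l) (auto simp: o_def)
  define \<eta> where "\<eta> = \<eta>0 \<circ> k"
  have \<eta>pos: "\<eta> n > 0" for n by (simp add: \<eta>_def \<eta>0_def)
  have \<eta>: "\<eta> \<longlonglongrightarrow> 0"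
    unfolding \<eta>_def using LIMSEQ_inverse_real_of_nat
    by (intro LIMSEQ_subseq_LIMSEQ[OF _ k]) (simp add: \<eta>0_def[abs_def])
  have X: "(\<lambda>n. X (\<eta> n)) \<longlonglongrightarrow> x" and T: "(\<lambda>n. T (\<eta> n)) \<longlonglongrightarrow> t"
    using tendsto_fst[OF lim] tendsto_snd[OF lim] by (simp_all add: \<eta>_def)
  have Xe: "(\<lambda>n. X (\<eta> n) + \<eta> n *\<^sub>R e) \<longlonglongrightarrow> x" and Ts: "(\<lambda>n. T (\<eta> n) + \<eta> n * s) \<longlonglongrightarrow> t"
    using tendsto_add[OF X tendsto_scaleR[OF \<eta> tendsto_const[of e]]]
      tendsto_add[OF T tendsto_mult[OF \<eta> tendsto_const[of s]]] by simp_all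
  have W_lim: "(\<lambda>n. W (\<eta> n) (Y n) (S n)) \<longlonglongrightarrow> v y s + L y s" if "Y \<longlonglongrightarrow> y" "S \<longlonglongrightarrow> s" for Y S y s
    using tendsto_add[OF difference_quotient_limit[OF v cont_v \<eta> \<eta>pos that] N_lim[OF \<eta> \<eta>pos that]]
    by (simp add: W_def)
  \<comment> \<open>Maximality of \<open>W\<close> against a fixed competitor passes to the
    limit.\<close>
  have max: "v y s + L y s \<le> v x t + L x t" for y s
    by (rule LIMSEQ_le[OF W_lim[OF tendsto_const tendsto_const] W_lim[OF X T]]) (use XT(3) \<eta>pos in auto)
  define a where "a n = (X (\<eta> n), D\<phi> (X (\<eta> n)) (T (\<eta> n)), T (\<eta> n))" for n
  define b where "b n = (X (\<eta> n) + \<eta> n *\<^sub>R e,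
    D\<phi> (X (\<eta> n) + \<eta> n *\<^sub>R e) (T (\<eta> n) + \<eta> n * s), T (\<eta> n) + \<eta> n * s)" for n
  have "a \<longlonglongrightarrow> (x, D\<phi> x t, t)" "b \<longlonglongrightarrow> (x, D\<phi> x t, t)"
    unfolding a_def b_def by (intro tendsto_Pair X T Xe Ts D\<phi>_tendsto)+
  moreover have "(\<lambda>n. (b n - a n) /\<^sub>R \<eta> n) \<longlonglongrightarrow> (e, - Lx x t, s)"
  proof -
    \<comment> \<open>By the first order condition the momentum component is the gradient of
      \<open>N\<close>, up to sign. Hence it converges although D\<phi> need not be differentiable
      in time.\<close>
    have eq: "(\<lambda>n. (b n - a n) /\<^sub>R \<eta> n) = (\<lambda>n. (e, (\<chi> i. - Nx (\<eta> n) i (X (\<eta> n)) (T (\<eta> n))), s))"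
      using \<eta>pos by (auto simp: a_def b_def vec_eq_iff XT(4)[OF \<eta>pos, symmetric] divide_inverse mult.commute less_imp_neq[THEN not_sym])
    have "(\<lambda>n. (\<chi> i. - Nx (\<eta> n) i (X (\<eta> n)) (T (\<eta> n)))) \<longlonglongrightarrow> - Lx x t"
      by (rule vec_tendstoI) (auto intro!: tendsto_minus Nx_lim[OF \<eta> \<eta>pos X T])
    then show ?thesis unfolding eq by (intro tendsto_Pair tendsto_const)
  qed
  ultimately have "(\<lambda>n. ((\<lambda>(x, p, t). H x p t) (b n) - (\<lambda>(x, p, t). H x p t) (a n)) / \<eta> n)
      \<longlonglongrightarrow> dH (x, D\<phi> x t, t) (e, - Lx x t, s)"
    by (rule H_quotient_limit)
  then have "(\<lambda>n. (H' (\<eta> n) (X (\<eta> n)) (T (\<eta> n)) - H (X (\<eta> n)) (D\<phi> (X (\<eta> n)) (T (\<eta> n))) (T (\<eta> n))) / \<eta> n)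
      \<longlonglongrightarrow> dH (x, D\<phi> x t, t) (e, - Lx x t, s)"
    by (simp add: H'_def a_def b_def)
  then have "LP x t \<le> dH (x, D\<phi> x t, t) (e, - Lx x t, s)"
    by (rule LIMSEQ_le[OF N_heat_lim[OF \<eta> \<eta>pos X T]]) (use XT(5) \<eta>pos in auto)
  from that[OF xt max this] show ?thesis .
qed

section \<open>Gradient bounds\<close>

lemma \<phi>_max: "\<exists>x t. \<forall>y s. \<phi> y s \<le> \<phi> x t"
  by (rule periodic_attains_max[OF periodic_\<phi> continuous_\<phi>]) blast

lemma \<phi>_min: "\<exists>x t. \<forall>y s. \<phi> x t \<le> \<phi> y s"
proof -
  have "periodic (\<lambda>x t. - \<phi> x t)"
    using periodic_combine[OF periodic_\<phi> periodic_\<phi>, of "\<lambda>a b. - a"] .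
  moreover have "continuous_on UNIV (\<lambda>(x, t). - \<phi> x t)"
    using continuous_\<phi> by (simp add: case_prod_beta continuous_on_minus)
  ultimately have "\<exists>x t. \<forall>y s. - \<phi> y s \<le> - \<phi> x t"
    by (rule periodic_attains_max) blast
  then show ?thesis by simp
qed

lemma jet_minus_\<phi>: "jet (\<lambda>x t. - 1 * \<phi> x t) (\<lambda>x t. - 1 * \<phi>t x t)
    (\<lambda>i x t. - 1 * D\<phi> x t $ i) (\<lambda>i x t. - 1 * D2\<phi> x t $ i $ i)"
  by (rule jet_cmult[OF jet_\<phi>])

text \<open>At a maximum of \<phi> the gradient vanishes and the heat operator is nonpositive; a
  minimum gives the opposite inequality \<open>c_ge\<close>. Thus \<open>c\<close> is confined by
  the values of \<open>H\<close> at zero momentum, uniformly in \<epsilon>.\<close>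

lemma c_le: obtains x t where "c \<le> H x 0 t"
proof -
  obtain x t where max: "\<And>y s. \<phi> y s \<le> \<phi> x t" using \<phi>_max by blast
  have "D\<phi> x t = 0" using jet_at_max(2)[OF jet_\<phi> max] by (simp add: vec_eq_iff)
  then show ?thesis using that[of x t] heat_op_at_max[OF jet_\<phi> max \<epsilon>] heat_op_\<phi>[of x t] by simp
qed

lemma c_ge: obtains x t where "H x 0 t \<le> c"
proof -
  obtain x t where "\<And>y s. \<phi> x t \<le> \<phi> y s" using \<phi>_min by blast
  then have max: "- 1 * \<phi> y s \<le> - 1 * \<phi> x t" for y s by simp
  have "D\<phi> x t = 0" using jet_at_max(2)[OF jet_minus_\<phi> max] by (simp add: vec_eq_iff)
  then show ?thesis
    using that[of x t] heat_op_at_max[OF jet_minus_\<phi> max \<epsilon>] heat_op_\<phi>[of x t]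
    by (simp add: heat_op_def sum_negf)
qed

text \<open>Bernstein's method with a correction \<open>G(\<phi>)\<close> of slope at least \<open>K\<close>.  The slight convexity of
  \<open>G\<close> makes the inequality at the maximum strict.\<close>

lemma gradient_le_height:
  assumes K: "K > 0" and growth: "\<And>x p t. norm p \<ge> K \<Longrightarrow>
      (H_p H x p t \<bullet> p - H x p t + (INF (y, s). H y 0 s)) * K - norm (H_x H x p t) \<ge> 0"
    and M: "\<And>y s. \<phi> y s \<le> M"
  shows "norm (D\<phi> y s) \<le> K + (K + 1) * (M - \<phi> y s)"
proof (cases "D\<phi> y s = 0")
  case True
  then show ?thesis using K M[of y s] by simp
next
  case False
  \<comment> \<open>Freezing the direction of the gradient at the point of interest replaces the
    norm by a linear expression that equals it there and is at most the norm elsewhere.\<close>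
  define e where "e = D\<phi> y s /\<^sub>R norm (D\<phi> y s)"
  have e: "norm e = 1" using False by (simp add: e_def)
  obtain xm tm where "\<And>y s. \<phi> xm tm \<le> \<phi> y s" using \<phi>_min by blast
  then obtain m where m: "\<And>y s. m \<le> \<phi> y s" by blast
  have mM: "m \<le> M" using m M order_trans by blast
  \<comment> \<open>With this value \<open>G'\<close> stays between \<open>K\<close> and
    \<open>K + 1\<close> on the range of \<phi>; the added 1 covers constant \<phi>.\<close>
  define \<eta> where "\<eta> = 1 / (M - m + 1)"
  have \<eta>: "\<eta> > 0" "\<eta> * (M - m) \<le> 1" using mM by (simp_all add: \<eta>_def)
  define G where "G r = K * r + \<eta> / 2 * (r - m)\<^sup>2" for r
  define G' where "G' r = K + \<eta> * (r - m)" for r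
  have G: "(G has_real_derivative G' r) (at r)" for r
    unfolding G_def[abs_def] G'_def by (auto intro!: derivative_eq_intros simp: field_simps)
  have G': "(G' has_real_derivative \<eta>) (at r)" for r
    unfolding G'_def[abs_def] by (auto intro!: derivative_eq_intros)
  have contG: "isCont G r" "isCont G' r" for r
    using G G' DERIV_isCont by blast+
  note jet_G = jet_compose[OF jet_\<phi> G G']
  have heat_G: "heat_op \<epsilon> (\<lambda>x t. G' (\<phi> x t) * \<phi>t x t)
      (\<lambda>i x t. \<eta> * (D\<phi> x t $ i)\<^sup>2 + G' (\<phi> x t) * D2\<phi> x t $ i $ i) x t =
      G' (\<phi> x t) * (c - H x (D\<phi> x t) t) + \<epsilon> * (\<eta> * (norm (D\<phi> x t))\<^sup>2)" for x t
    unfolding heat_op_\<phi>[symmetric] heat_op_def power2_norm_eq_inner inner_vec_def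
    by (simp add: sum.distrib algebra_simps power2_eq_square flip: sum_distrib_left)
  obtain x t where max: "\<And>y s. D\<phi> y s \<bullet> e + G (\<phi> y s) \<le> D\<phi> x t \<bullet> e + G (\<phi> x t)"
    and ineq: "G' (\<phi> x t) * (c - H x (D\<phi> x t) t) + \<epsilon> * (\<eta> * (norm (D\<phi> x t))\<^sup>2)
      \<le> dH (x, D\<phi> x t, t) (e, - (G' (\<phi> x t) *\<^sub>R D\<phi> x t), 0)"
  proof (rule bernstein[where e = e and s = 0 and v = "\<lambda>x t. D\<phi> x t \<bullet> e"
        and N = "\<lambda>h x t. G (\<phi> x t)" and L = "\<lambda>x t. G (\<phi> x t)"
        and Nt = "\<lambda>h x t. G' (\<phi> x t) * \<phi>t x t"
        and Nx = "\<lambda>h i x t. G' (\<phi> x t) * D\<phi> x t $ i"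
        and Nxx = "\<lambda>h i x t. \<eta> * (D\<phi> x t $ i)\<^sup>2 + G' (\<phi> x t) * D2\<phi> x t $ i $ i"
        and Lx = "\<lambda>x t. G' (\<phi> x t) *\<^sub>R D\<phi> x t"
        and LP = "\<lambda>x t. G' (\<phi> x t) * (c - H x (D\<phi> x t) t) + \<epsilon> * (\<eta> * (norm (D\<phi> x t))\<^sup>2)"])
    show "((\<lambda>r. \<phi> (x + r *\<^sub>R e) (t + r * 0)) has_real_derivative D\<phi> x t \<bullet> e) (at 0)" for x t
      using \<phi>_line[of x e t 0] by simp
    show "continuous_on UNIV (\<lambda>(x, t). D\<phi> x t \<bullet> e)"
      using continuous_D\<phi> unfolding case_prod_beta by (intro continuous_intros)
    show "jet (\<lambda>x t. G (\<phi> x t)) (\<lambda>x t. G' (\<phi> x t) * \<phi>t x t) (\<lambda>i x t. G' (\<phi> x t) * D\<phi> x t $ i)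
        (\<lambda>i x t. \<eta> * (D\<phi> x t $ i)\<^sup>2 + G' (\<phi> x t) * D2\<phi> x t $ i $ i)"
      by (rule jet_G)
    show "continuous_on UNIV (\<lambda>(x, t). G (\<phi> x t))"
      using continuous_\<phi> unfolding case_prod_beta G_def by (intro continuous_intros)
    show "periodic (\<lambda>x t. G (\<phi> x t))"
      using periodic_combine[OF periodic_\<phi> periodic_\<phi>, of "\<lambda>a b. G a"] .
    fix X :: "nat \<Rightarrow> real^'n" and T :: "nat \<Rightarrow> real" and x t i
    assume lim: "X \<longlonglongrightarrow> x" "T \<longlonglongrightarrow> t"
    note [tendsto_intros] = \<phi>_tendsto[OF lim] D\<phi>_tendsto[OF lim] H_tendsto
      isCont_tendsto_compose[OF contG(1)] isCont_tendsto_compose[OF contG(2)]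
    show "(\<lambda>n. G (\<phi> (X n) (T n))) \<longlonglongrightarrow> G (\<phi> x t)"
      by (intro tendsto_intros)
    show "(\<lambda>n. G' (\<phi> (X n) (T n)) * D\<phi> (X n) (T n) $ i) \<longlonglongrightarrow> (G' (\<phi> x t) *\<^sub>R D\<phi> x t) $ i"
      by (auto intro!: tendsto_intros)
    show "(\<lambda>n. heat_op \<epsilon> (\<lambda>x t. G' (\<phi> x t) * \<phi>t x t)
      (\<lambda>i x t. \<eta> * (D\<phi> x t $ i)\<^sup>2 + G' (\<phi> x t) * D2\<phi> x t $ i $ i) (X n) (T n)) \<longlonglongrightarrow>
      G' (\<phi> x t) * (c - H x (D\<phi> x t) t) + \<epsilon> * (\<eta> * (norm (D\<phi> x t))\<^sup>2)"
      unfolding heat_G by (intro tendsto_intros lim)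
  qed blast
  have "D\<phi> x t \<bullet> e \<le> K"
  proof (rule ccontr)
    assume "\<not> D\<phi> x t \<bullet> e \<le> K"
    then have "K < norm (D\<phi> x t) * norm e"
      using norm_cauchy_schwarz[of "D\<phi> x t" e] by linarith
    then have large: "K < norm (D\<phi> x t)" using e by simp
    define l where "l = H_p H x (D\<phi> x t) t \<bullet> D\<phi> x t - H x (D\<phi> x t) t"
    have gr: "norm (H_x H x (D\<phi> x t) t) \<le> K * (l + (INF (y, s). H y 0 s))"
      using growth[of "D\<phi> x t" x t] large by (simp add: l_def mult.commute)
    have "\<exists>x t. H x 0 t \<le> c" by (rule c_ge) blast
    then have "(INF (y, s). H y 0 s) \<le> c" using Inf_H_zero_le order_trans by blast
    then have "K * (l + (INF (y, s). H y 0 s)) \<le> K * (l + c)"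
      using K by (intro mult_left_mono) auto
    with gr have "norm (H_x H x (D\<phi> x t) t) \<le> K * (l + c)" by (rule order_trans)
    \<comment> \<open>The growth condition also forces \<open>l + c\<close> to be nonnegative, which
      permits enlarging the factor \<open>K\<close> to \<open>G'\<close>. The term with \<eta> then
      contradicts \<open>ineq\<close> strictly.\<close>
    moreover from this have "0 \<le> K * (l + c)" using norm_ge_zero order_trans by blast
    then have "0 \<le> l + c" using K by (simp add: zero_le_mult_iff)
    then have "K * (l + c) \<le> G' (\<phi> x t) * (l + c)"
      using \<eta>(1) m[of x t] by (intro mult_right_mono) (auto simp: G'_def)
    moreover have "H_x H x (D\<phi> x t) t \<bullet> e \<le> norm (H_x H x (D\<phi> x t) t)"
      using norm_cauchy_schwarz[of "H_x H x (D\<phi> x t) t" e] e by simp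
    moreover have "\<epsilon> * (\<eta> * (norm (D\<phi> x t))\<^sup>2) > 0"
      using \<epsilon> \<eta>(1) large K by (intro mult_pos_pos zero_less_power) auto
    moreover have "dH (x, D\<phi> x t, t) (e, - (G' (\<phi> x t) *\<^sub>R D\<phi> x t), 0) =
        H_x H x (D\<phi> x t) t \<bullet> e - G' (\<phi> x t) * (H_p H x (D\<phi> x t) t \<bullet> D\<phi> x t)"
      by (simp add: dH_space_momentum)
    ultimately show False using ineq by (simp add: l_def algebra_simps)
  qed
  moreover have "D\<phi> y s \<bullet> e = norm (D\<phi> y s)"
    using False by (simp add: e_def dot_square_norm power2_eq_square)
  moreover have "G (\<phi> x t) - G (\<phi> y s) \<le> (K + 1) * (M - \<phi> y s)"
  proof -
    have "G (\<phi> x t) \<le> G M"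
      unfolding G_def using K \<eta>(1) M[of x t] m[of x t]
      by (intro add_mono mult_left_mono power_mono) auto
    \<comment> \<open>As \<open>G\<close> is quadratic, its chord slope is the mean of the two end
      slopes, hence at most \<open>K + 1\<close>.\<close>
    moreover have "G M - G (\<phi> y s) = (K + \<eta> * ((M - m) + (\<phi> y s - m)) / 2) * (M - \<phi> y s)"
      by (simp add: G_def power2_eq_square field_simps)
    moreover have "\<dots> \<le> (K + 1) * (M - \<phi> y s)"
    proof (rule mult_right_mono)
      have "\<eta> * (\<phi> y s - m) \<le> \<eta> * (M - m)" using \<eta>(1) M[of y s] by simp
      then show "K + \<eta> * ((M - m) + (\<phi> y s - m)) / 2 \<le> K + 1"
        using \<eta>(2) distrib_left[of \<eta> "M - m" "\<phi> y s - m"] by linarith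
    qed (use M[of y s] in simp)
    ultimately show ?thesis by linarith
  qed
  ultimately show ?thesis using max[of y s] by linarith
qed

section \<open>Oscillation of \<phi> and the gradient bound\<close>

text \<open>Along a segment starting at \<open>x0\<close> the gradient estimate is a linear
  differential inequality for the height below the maximum plus 1, which equals 1 at
  \<open>x0\<close>; Gronwall's argument applies. The end point is a periodic copy of
  \<open>x\<close> in the unit cube attached to \<open>x0\<close>, so the segment has length at most
  the dimension.\<close>

lemma harnack_at_max_time:
  assumes \<kappa>: "\<kappa> \<ge> 0" and grad: "\<And>y. norm (D\<phi> y t0) \<le> \<kappa> * (\<phi> x0 t0 - \<phi> y t0 + 1)"
    and max: "\<And>y. \<phi> y t0 \<le> \<phi> x0 t0"
  shows "\<phi> x0 t0 - \<phi> x t0 + 1 \<le> exp (\<kappa> * CARD('n))"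
proof -
  obtain z where z: "\<And>i. z $ i \<in> \<int>" "x - x0 + z \<in> cbox 0 1" using shift_to_unit_cube[of "x - x0"] by blast
  define w where "w = x - x0 + z"
  have "norm w \<le> (\<Sum>i\<in>UNIV. \<bar>w $ i\<bar>)" by (rule norm_le_l1_cart)
  also have "\<dots> \<le> (\<Sum>i\<in>(UNIV::'n set). 1)"
    using z(2) by (intro sum_mono) (auto simp: w_def mem_box_cart abs_le_iff)
  finally have w: "norm w \<le> CARD('n)" by simp
  define f where "f r = \<phi> x0 t0 - \<phi> (x0 + r *\<^sub>R w) t0 + 1" for r
  \<comment> \<open>The integrating factor turns the differential inequality into
    monotonicity.\<close>
  define g where "g r = f r * exp (- (\<kappa> * CARD('n)) * r)" for r
  have "g 1 \<le> g 0"
  proof (rule DERIV_nonpos_imp_nonincreasing[of 0 1 g])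
    fix r :: real
    have "(f has_real_derivative - (D\<phi> (x0 + r *\<^sub>R w) t0 \<bullet> w)) (at r)"
      unfolding f_def[abs_def] by (auto intro!: derivative_eq_intros \<phi>_line)
    then have "(g has_real_derivative
        (- (D\<phi> (x0 + r *\<^sub>R w) t0 \<bullet> w) - \<kappa> * CARD('n) * f r) * exp (- (\<kappa> * CARD('n)) * r)) (at r)"
      unfolding g_def[abs_def] by (auto intro!: derivative_eq_intros simp: algebra_simps)
    moreover have "- (D\<phi> (x0 + r *\<^sub>R w) t0 \<bullet> w) \<le> \<kappa> * CARD('n) * f r"
    proof -
      have "- (D\<phi> (x0 + r *\<^sub>R w) t0 \<bullet> w) \<le> norm (D\<phi> (x0 + r *\<^sub>R w) t0) * norm w"
        using norm_cauchy_schwarz[of "- D\<phi> (x0 + r *\<^sub>R w) t0" w] by simp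
      also have "\<dots> \<le> (\<kappa> * f r) * CARD('n)"
        using grad[of "x0 + r *\<^sub>R w"] w by (intro mult_mono) (auto simp: f_def \<kappa> max intro: order_trans[OF norm_ge_zero])
      finally show ?thesis by (simp add: mult_ac)
    qed
    ultimately show "\<exists>D. (g has_real_derivative D) (at r) \<and> D \<le> 0"
      by (intro exI[of _ "(- (D\<phi> (x0 + r *\<^sub>R w) t0 \<bullet> w) - \<kappa> * CARD('n) * f r) * exp (- (\<kappa> * CARD('n)) * r)"])
        (auto intro!: mult_nonpos_nonneg)
  qed simp
  moreover have "\<phi> (x0 + w) t0 = \<phi> x t0"
    using periodic_\<phi> z(1) by (simp add: w_def periodic_def torus_periodic_def)
  ultimately show ?thesis by (simp add: g_def f_def exp_minus field_simps)
qed

text \<open>After adding \<open>B * (t0 - s)\<close>, the minimum over the time slab is attained at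
  time \<open>t0\<close>: at an earlier minimum the gradient vanishes and the Laplacian is
  nonnegative, so the equation gives a time derivative below \<open>B\<close>, and the tilted
  function would still decrease.\<close>

lemma min_propagates_backwards:
  assumes a: "\<And>x. a \<le> \<phi> x t0" and B: "B > c - (INF (y, s). H y 0 s)" and t: "t \<le> t0"
  shows "a - B * (t0 - t) \<le> \<phi> x t"
proof -
  define \<psi> where "\<psi> y s = \<phi> y s + B * (t0 - s)" for y s
  let ?S = "cbox (0::real^'n) 1 \<times> {t..t0}"
  have "(0, t) \<in> ?S" using t by (auto simp: mem_box_cart)
  then have "?S \<noteq> {}" by blast
  moreover have "compact ?S" by (intro compact_Times) auto
  moreover have "continuous_on ?S (\<lambda>z. \<psi> (fst z) (snd z))"
    using continuous_on_subset[OF continuous_\<phi>, of ?S]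
    unfolding \<psi>_def case_prod_beta by (intro continuous_intros) auto
  ultimately obtain z where z: "z \<in> ?S" "\<And>w. w \<in> ?S \<Longrightarrow> \<psi> (fst z) (snd z) \<le> \<psi> (fst w) (snd w)"
    using continuous_attains_inf[of ?S] by blast
  obtain x1 s1 where [simp]: "z = (x1, s1)" by (cases z)
  have min: "\<psi> x1 s1 \<le> \<psi> y s" if "s \<in> {t..t0}" for y s
  proof -
    obtain k where k: "\<And>i. k $ i \<in> \<int>" "y + k \<in> cbox 0 1" using shift_to_unit_cube[of y] by blast
    have "\<psi> (y + k) s = \<psi> y s"
      using periodic_\<phi> k(1) by (simp add: \<psi>_def periodic_def torus_periodic_def)
    then show ?thesis using z(2)[of "(y + k, s)"] k(2) that by simp
  qed
  have s1: "s1 \<in> {t..t0}" using z(1) by simp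
  have "s1 = t0"
  proof (rule ccontr)
    assume "s1 \<noteq> t0"
    then have less: "s1 < t0" using s1 by simp
    have "- 1 * \<phi> y s1 \<le> - 1 * \<phi> x1 s1" for y
      using min[OF s1, of y] by (simp add: \<psi>_def)
    note space = jet_at_space_max[OF jet_minus_\<phi> this]
    have "D\<phi> x1 s1 = 0" using space(1) by (simp add: vec_eq_iff)
    moreover have "\<epsilon> * (\<Sum>i\<in>UNIV. D2\<phi> x1 s1 $ i $ i) \<ge> 0"
      using space(2) \<epsilon> by (intro mult_nonneg_nonneg sum_nonneg) auto
    ultimately have "\<phi>t x1 s1 \<le> c - H x1 0 s1"
      using heat_op_\<phi>[of x1 s1] by (simp add: heat_op_def)
    then have neg: "\<phi>t x1 s1 - B < 0" using B Inf_H_zero_le[of x1 s1] by linarith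
    have "(\<psi> x1 has_real_derivative \<phi>t x1 s1 - B) (at s1)"
      unfolding \<psi>_def[abs_def] by (auto intro!: derivative_eq_intros jetD(1)[OF jet_\<phi>])
    from DERIV_neg_dec_right[OF this neg] obtain d where
      d: "d > 0" "\<And>h. 0 < h \<Longrightarrow> h < d \<Longrightarrow> \<psi> x1 (s1 + h) < \<psi> x1 s1" by auto
    \<comment> \<open>The second argument of \<open>min\<close> keeps the later time inside the
      slab.\<close>
    define h where "h = min (d / 2) (t0 - s1)"
    have "0 < h" "h < d" "s1 + h \<in> {t..t0}" using d(1) less s1 by (auto simp: h_def min_def)
    then show False using d(2)[of h] min[of "s1 + h" x1] by fastforce
  qed
  then have "a \<le> \<psi> x1 s1" using a by (simp add: \<psi>_def)
  also have "\<dots> \<le> \<psi> x t" using min[of t x] t by simp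
  finally show ?thesis by (simp add: \<psi>_def)
qed

text \<open>The Harnack estimate bounds \<phi> from below at the time of its maximum. Any other time
  is, up to periodicity, at most one period earlier, which costs at most \<open>B\<close>. The
  resulting oscillation bound enters \<open>gradient_le_height\<close>.\<close>

lemma gradient_bound:
  assumes K: "K > 0" and growth: "\<And>x p t. norm p \<ge> K \<Longrightarrow>
      (H_p H x p t \<bullet> p - H x p t + (INF (y, s). H y 0 s)) * K - norm (H_x H x p t) \<ge> 0"
    and C: "\<And>x t. H x 0 t \<le> C"
  shows "norm (D\<phi> x t) \<le> K + (K + 1) * (exp ((K + 1) * CARD('n)) + C - (INF (y, s). H y 0 s))"
proof -
  obtain x0 t0 where max: "\<And>y s. \<phi> y s \<le> \<phi> x0 t0" using \<phi>_max by blast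
  note height = gradient_le_height[OF K growth max]
  have "norm (D\<phi> y t0) \<le> (K + 1) * (\<phi> x0 t0 - \<phi> y t0 + 1)" for y
    using height[of y t0] by (simp add: algebra_simps)
  then have "\<phi> x0 t0 - \<phi> y t0 + 1 \<le> exp ((K + 1) * CARD('n))" for y
    using harnack_at_max_time[of "K + 1"] K max by simp
  then have low: "\<phi> x0 t0 + 1 - exp ((K + 1) * CARD('n)) \<le> \<phi> y t0" for y
    by (simp add: algebra_simps)
  \<comment> \<open>The 1 makes the inequality required of \<open>B\<close> strict; it cancels
    against the 1 in the Harnack estimate.\<close>
  define B where "B = C - (INF (y, s). H y 0 s) + 1"
  obtain x' t' where "c \<le> H x' 0 t'" using c_le by blast
  then have B: "B > c - (INF (y, s). H y 0 s)" using C[of x' t'] by (simp add: B_def)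
  have "B \<ge> 0" using B Inf_H_zero_le c_ge by (smt (verit))
  \<comment> \<open>The integer translate of \<open>t\<close> in the unit time interval ending at
    \<open>t0\<close>.\<close>
  define s where "s = t - of_int \<lceil>t - t0\<rceil>"
  have s: "s \<le> t0" "t0 - s \<le> 1" unfolding s_def by linarith+
  have "\<phi> x t = \<phi> x s"
    using periodic_shift_int[of "\<phi> x" s "\<lceil>t - t0\<rceil>"] periodic_\<phi> by (simp add: s_def periodic_def)
  moreover have "B * (t0 - s) \<le> B" using s \<open>B \<ge> 0\<close> by (simp add: mult_left_le)
  moreover note min_propagates_backwards[OF low B s(1), of x]
  ultimately have "\<phi> x0 t0 - \<phi> x t \<le> exp ((K + 1) * CARD('n)) + C - (INF (y, s). H y 0 s)"
    unfolding B_def by linarith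
  then have "(K + 1) * (\<phi> x0 t0 - \<phi> x t) \<le> (K + 1) * (exp ((K + 1) * CARD('n)) + C - (INF (y, s). H y 0 s))"
    using K by (intro mult_left_mono) auto
  then show ?thesis using height[of x t] by linarith
qed

section \<open>A bound on \<epsilon>|D\<phi>|\<close>

lemma \<phi>_add_axis: "\<phi> (x + axis i 1) t = \<phi> x t"
  using periodic_\<phi> unfolding periodic_def torus_periodic_def by (auto simp: axis_def)

text \<open>Doubling of variables along a coordinate line with a concave modulus: where
  \<open>\<phi>(x + r e) - \<phi>(x) - B r (1 - r)\<close> is maximal, moving the two points apart at equal speed shows that
  the difference of the Laplacians is at most \<open>-8B\<close>.\<close>

lemma concave_modulus:
  assumes R: "\<And>x t. norm (D\<phi> x t) \<le> R" and C: "\<And>x p t. norm p \<le> R \<Longrightarrow> \<bar>H x p t\<bar> \<le> C"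
    and B: "4 * \<epsilon> * B > C" and r: "r \<in> {0..1}"
  shows "\<phi> (x + r *\<^sub>R axis i 1) t - \<phi> x t \<le> B * (r * (1 - r))"
proof (rule ccontr)
  assume contra: "\<not> \<phi> (x + r *\<^sub>R axis i 1) t - \<phi> x t \<le> B * (r * (1 - r))"
  define a :: "real^'n" where "a = axis i 1"
  define W where "W x t r = \<phi> (x + r *\<^sub>R a) t - \<phi> x t - B * (r * (1 - r))" for x t r
  have per_a: "\<phi> (y + a) s = \<phi> y s" for y s
    by (simp add: a_def \<phi>_add_axis)
  let ?S = "cbox (0::real^'n) 1 \<times> {0..1::real} \<times> {0..1::real}"
  have "(0, 0, 0) \<in> ?S" by (auto simp: mem_box_cart)
  then have "?S \<noteq> {}" by blast
  moreover have "compact ?S" by (intro compact_Times) auto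
  moreover have "continuous_on ?S (\<lambda>z. W (fst z) (fst (snd z)) (snd (snd z)))"
  proof -
    have "continuous_on ?S (\<lambda>z. \<phi> (fst z + snd (snd z) *\<^sub>R a) (fst (snd z)))"
      using continuous_on_compose2[OF continuous_\<phi>, of ?S "\<lambda>z. (fst z + snd (snd z) *\<^sub>R a, fst (snd z))"]
      by (simp add: continuous_intros)
    moreover have "continuous_on ?S (\<lambda>z. \<phi> (fst z) (fst (snd z)))"
      using continuous_on_compose2[OF continuous_\<phi>, of ?S "\<lambda>z. (fst z, fst (snd z))"]
      by (simp add: continuous_intros)
    ultimately show ?thesis unfolding W_def by (intro continuous_intros)
  qed
  ultimately obtain z where z: "z \<in> ?S"
      "\<And>w. w \<in> ?S \<Longrightarrow> W (fst w) (fst (snd w)) (snd (snd w)) \<le> W (fst z) (fst (snd z)) (snd (snd z))"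
    using continuous_attains_sup[of ?S] by blast
  obtain x0 t0 r0 where z_eq: "z = (x0, t0, r0)" by (cases z)
  have max: "W y s q \<le> W x0 t0 r0" if "q \<in> {0..1}" for y s q
  proof -
    have "periodic (\<lambda>y s. W y s q)"
      unfolding W_def
      using periodic_combine[OF periodic_translate[OF periodic_\<phi>] periodic_\<phi>, of "\<lambda>u v. u - v - B * (q * (1 - q))" "q *\<^sub>R a" 0]
      by simp
    then obtain y' s' where "y' \<in> cbox 0 1" "s' \<in> {0..1}" "W y' s' q = W y s q"
      by (rule periodic_reduce)
    then show ?thesis using z(2)[of "(y', s', q)"] that z_eq by simp
  qed
  have "W x0 t0 r0 > 0"
    using max[OF r, of x t] contra by (simp add: W_def a_def)
  \<comment> \<open>At distance 1 this is periodicity. A positive maximum therefore has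
    \<open>r0\<close> in the open interval, leaving room to vary it.\<close>
  moreover have "W x0 t0 0 = 0" "W x0 t0 1 = 0" using per_a by (simp_all add: W_def)
  moreover have "r0 \<in> {0..1}" using z(1) z_eq by simp
  ultimately have r0: "0 < r0" "r0 < 1" by (cases "r0 = 0"; cases "r0 = 1"; force)+
  define y0 where "y0 = x0 + r0 *\<^sub>R a"
  \<comment> \<open>With \<open>r0\<close> frozen, the maximum in \<open>(x, t)\<close> equates the
    gradients and time derivatives at both points and orders the pure second derivatives.\<close>
  have jet_u: "jet (\<lambda>x t. \<phi> (x + r0 *\<^sub>R a) (t + 0) + - 1 * \<phi> x t)
    (\<lambda>x t. \<phi>t (x + r0 *\<^sub>R a) (t + 0) + - 1 * \<phi>t x t)
    (\<lambda>i x t. D\<phi> (x + r0 *\<^sub>R a) (t + 0) $ i + - 1 * D\<phi> x t $ i)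
    (\<lambda>i x t. D2\<phi> (x + r0 *\<^sub>R a) (t + 0) $ i $ i + - 1 * D2\<phi> x t $ i $ i)"
    by (rule jet_add[OF jet_translate[OF jet_\<phi>] jet_minus_\<phi>])
  have "\<phi> (y + r0 *\<^sub>R a) (s + 0) + - 1 * \<phi> y s \<le> \<phi> (x0 + r0 *\<^sub>R a) (t0 + 0) + - 1 * \<phi> x0 t0" for y s
    using max[of r0 y s] r0 by (simp add: W_def)
  note u = jet_at_max[OF jet_u this]
  have eq_t: "\<phi>t y0 t0 = \<phi>t x0 t0" and eq_D: "D\<phi> y0 t0 = D\<phi> x0 t0"
    and le_D2: "D2\<phi> y0 t0 $ j $ j \<le> D2\<phi> x0 t0 $ j $ j" for j
    using u by (simp_all add: y0_def vec_eq_iff)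
  \<comment> \<open>Moving the ends by \<open>q\<close> in opposite directions changes
    \<open>r0\<close> to \<open>r0 + 2 * q\<close>; in \<open>q\<close>, the concave term has second
    derivative \<open>- 8 * B\<close>. The bound on \<open>q\<close> keeps the distance in the unit
    interval.\<close>
  have le_i: "D2\<phi> y0 t0 $ i $ i - D2\<phi> x0 t0 $ i $ i + 8 * B \<le> 0"
  proof (rule second_derivative_at_max(2))
    let ?f' = "\<lambda>q. D\<phi> (y0 + q *\<^sub>R a) t0 $ i + D\<phi> (x0 + q *\<^sub>R (- a)) t0 $ i - B * (2 - 4 * r0 - 8 * q)"
    have y_line: "((\<lambda>q. \<phi> (y0 + q *\<^sub>R a) t0) has_real_derivative D\<phi> (y0 + q *\<^sub>R a) t0 $ i) (at q)"
      and x_line: "((\<lambda>q. \<phi> (x0 + q *\<^sub>R (- a)) t0) has_real_derivative - D\<phi> (x0 + q *\<^sub>R (- a)) t0 $ i) (at q)" for q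
      using \<phi>_line[of y0 a t0 q] \<phi>_line[of x0 "- a" t0 q] by (simp_all add: a_def inner_axis)
    show "((\<lambda>q. \<phi> (y0 + q *\<^sub>R a) t0 - \<phi> (x0 + q *\<^sub>R (- a)) t0 - B * ((r0 + 2 * q) * (1 - r0 - 2 * q)))
        has_real_derivative ?f' q) (at q)" for q
      by (rule derivative_eq_intros y_line x_line refl | simp add: algebra_simps)+
    have y2: "((\<lambda>q. D\<phi> (y0 + q *\<^sub>R a) t0 $ i) has_real_derivative D2\<phi> y0 t0 $ i $ i) (at 0)"
      using D\<phi>_line[of y0 i t0 i 0] by (simp add: a_def)
    have "((\<lambda>q. D\<phi> (x0 + q *\<^sub>R a) t0 $ i) has_real_derivative D2\<phi> x0 t0 $ i $ i) (at (- 0))"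
      using D\<phi>_line[of x0 i t0 i 0] by (simp add: a_def)
    then have x2: "((\<lambda>q. D\<phi> (x0 + q *\<^sub>R (- a)) t0 $ i) has_real_derivative - D2\<phi> x0 t0 $ i $ i) (at 0)"
      unfolding DERIV_mirror by simp
    show "(?f' has_real_derivative D2\<phi> y0 t0 $ i $ i - D2\<phi> x0 t0 $ i $ i + 8 * B) (at 0)"
      by (rule derivative_eq_intros y2 x2 refl | simp)+
    show "min r0 (1 - r0) / 2 > 0" using r0 by simp
    fix q assume "\<bar>q\<bar> < min r0 (1 - r0) / 2"
    then have "r0 + 2 * q \<in> {0..1}" by (auto simp: min_def abs_if split: if_splits)
    from max[OF this, of "x0 + q *\<^sub>R (- a)" t0]
    have "\<phi> (x0 + q *\<^sub>R (- a) + (r0 + 2 * q) *\<^sub>R a) t0 - \<phi> (x0 + q *\<^sub>R (- a)) t0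
        - B * ((r0 + 2 * q) * (1 - (r0 + 2 * q))) \<le> \<phi> y0 t0 - \<phi> x0 t0 - B * (r0 * (1 - r0))"
      by (simp only: W_def y0_def)
    moreover have "x0 + q *\<^sub>R (- a) + (r0 + 2 * q) *\<^sub>R a = y0 + q *\<^sub>R a"
      by (simp add: y0_def vec_eq_iff algebra_simps)
    ultimately show "\<phi> (y0 + q *\<^sub>R a) t0 - \<phi> (x0 + q *\<^sub>R (- a)) t0 - B * ((r0 + 2 * q) * (1 - r0 - 2 * q)) \<le>
        \<phi> (y0 + 0 *\<^sub>R a) t0 - \<phi> (x0 + 0 *\<^sub>R (- a)) t0 - B * ((r0 + 2 * 0) * (1 - r0 - 2 * 0))"
      by (simp only: diff_diff_eq mult_zero_right add_0_right scaleR_zero_left)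
  qed
  have "(\<Sum>j\<in>UNIV. D2\<phi> y0 t0 $ j $ j) - (\<Sum>j\<in>UNIV. D2\<phi> x0 t0 $ j $ j)
      = (\<Sum>j\<in>UNIV. D2\<phi> y0 t0 $ j $ j - D2\<phi> x0 t0 $ j $ j)"
    by (simp add: sum_subtractf)
  also have "\<dots> = (D2\<phi> y0 t0 $ i $ i - D2\<phi> x0 t0 $ i $ i)
      + (\<Sum>j\<in>UNIV - {i}. D2\<phi> y0 t0 $ j $ j - D2\<phi> x0 t0 $ j $ j)"
    by (simp add: sum.remove)
  also have "\<dots> \<le> - 8 * B + 0"
    using le_i le_D2 by (intro add_mono sum_nonpos) auto
  finally have "\<epsilon> * ((\<Sum>j\<in>UNIV. D2\<phi> y0 t0 $ j $ j) - (\<Sum>j\<in>UNIV. D2\<phi> x0 t0 $ j $ j)) \<le> \<epsilon> * (- 8 * B)"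
    using \<epsilon> by (intro mult_left_mono) auto
  \<comment> \<open>Subtracting the equation at the two points leaves only a difference of
    \<open>H\<close> at the same momentum and time, at most \<open>2 * C\<close> in size, against
    \<open>8 * \<epsilon> * B\<close> from the Laplacians.\<close>
  moreover have "\<epsilon> * ((\<Sum>j\<in>UNIV. D2\<phi> y0 t0 $ j $ j) - (\<Sum>j\<in>UNIV. D2\<phi> x0 t0 $ j $ j))
      = H x0 (D\<phi> x0 t0) t0 - H y0 (D\<phi> x0 t0) t0"
    using heat_op_\<phi>[of x0 t0] heat_op_\<phi>[of y0 t0] by (simp add: heat_op_def eq_t eq_D algebra_simps)
  moreover have "H y0 (D\<phi> x0 t0) t0 - H x0 (D\<phi> x0 t0) t0 \<le> 2 * C"
    using C[OF R[of x0 t0], of x0 t0] C[OF R[of x0 t0], of y0 t0] by (simp add: abs_le_iff)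
  ultimately show False using B by simp
qed

text \<open>The modulus \<open>B * (r * (1 - r))\<close> has slope \<open>B\<close> at 0 and
  \<open>- B\<close> at 1. By periodicity the increment of \<phi> along a coordinate line touches it
  at both ends, which confines each partial derivative to the interval from \<open>- B\<close> to
  \<open>B\<close>.\<close>

lemma scaled_gradient_bound:
  fixes R C :: real
  assumes R: "\<And>x t. norm (D\<phi> x t) \<le> R" and C: "\<And>x p t. norm p \<le> R \<Longrightarrow> \<bar>H x p t\<bar> \<le> C"
  shows "\<epsilon> * norm (D\<phi> x t) \<le> CARD('n) * (C + 1)"
proof -
  \<comment> \<open>Then \<open>4 * \<epsilon> * B\<close> is \<open>4 * (C + 1)\<close>, above
    \<open>C\<close>, and \<epsilon> drops out of \<open>\<epsilon> * B\<close>.\<close>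
  define B where "B = (C + 1) / \<epsilon>"
  have "R \<ge> 0" using R norm_ge_zero order_trans by blast
  then have "C \<ge> 0" using C[of 0 0 0] abs_ge_zero order_trans by force
  then have B: "4 * \<epsilon> * B > C" using \<epsilon> by (simp add: B_def)
  have modulus: "\<phi> (y + r *\<^sub>R axis i 1) t - \<phi> y t \<le> B * (r * (1 - r))" if "r \<in> {0..1}" for y i r
    by (rule concave_modulus[OF R _ B that]) (rule C)
  have quad: "((\<lambda>r. B * (r * (1 - r))) has_real_derivative B * (1 - 2 * r)) (at r)" for r
    by (auto intro!: derivative_eq_intros simp: algebra_simps)
  have upper: "D\<phi> y t $ i \<le> B" for y i
  proof (rule ccontr)
    assume "\<not> D\<phi> y t $ i \<le> B"
    then have "D\<phi> y t $ i - B * (1 - 2 * 0) > 0" by simp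
    moreover have "((\<lambda>r. \<phi> (y + r *\<^sub>R axis i 1) t - B * (r * (1 - r))) has_real_derivative
        D\<phi> y t $ i - B * (1 - 2 * 0)) (at 0)"
      using DERIV_diff[OF jetD(2)[OF jet_\<phi>] quad] .
    ultimately obtain d where d: "d > 0" "\<And>h. 0 < h \<Longrightarrow> h < d \<Longrightarrow>
        \<phi> (y + 0 *\<^sub>R axis i 1) t - B * (0 * (1 - 0)) < \<phi> (y + (0 + h) *\<^sub>R axis i 1) t - B * ((0 + h) * (1 - (0 + h)))"
      using DERIV_pos_inc_right by blast
    define h where "h = min (d / 2) 1"
    have "0 < h" "h < d" "h \<in> {0..1}" using d(1) by (auto simp: h_def min_def)
    then show False using d(2)[of h] modulus[of h y i] by simp
  qed
  have lower: "- B \<le> D\<phi> y t $ i" for y i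
  proof (rule ccontr)
    assume "\<not> - B \<le> D\<phi> y t $ i"
    \<comment> \<open>Starting one period earlier lets the line reach \<open>y\<close> at the right
      end \<open>r = 1\<close>.\<close>
    define x where "x = y - axis i 1"
    have x1: "x + 1 *\<^sub>R axis i 1 = y" by (simp add: x_def)
    have per: "\<phi> x t = \<phi> y t"
      using \<phi>_add_axis[of x i t] x1 by simp
    have "D\<phi> (x + 1 *\<^sub>R axis i 1) t $ i - B * (1 - 2 * 1) < 0"
      using \<open>\<not> - B \<le> D\<phi> y t $ i\<close> unfolding x1 by simp
    moreover have "((\<lambda>r. \<phi> (x + r *\<^sub>R axis i 1) t - B * (r * (1 - r))) has_real_derivative
        D\<phi> (x + 1 *\<^sub>R axis i 1) t $ i - B * (1 - 2 * 1)) (at 1)"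
      using DERIV_diff[OF jet_line[OF jet_\<phi>] quad] .
    ultimately obtain d where d: "d > 0" "\<And>h. 0 < h \<Longrightarrow> h < d \<Longrightarrow>
        \<phi> (x + 1 *\<^sub>R axis i 1) t - B * (1 * (1 - 1)) < \<phi> (x + (1 - h) *\<^sub>R axis i 1) t - B * ((1 - h) * (1 - (1 - h)))"
      using DERIV_neg_dec_left by blast
    define h where "h = min (d / 2) 1"
    have h: "0 < h" "h < d" "1 - h \<in> {0..1}" using d(1) by (auto simp: h_def min_def)
    then show False using d(2)[OF h(1,2)] modulus[OF h(3), of x i] unfolding x1 by (simp add: per)
  qed
  have "norm (D\<phi> x t) \<le> (\<Sum>i\<in>UNIV. \<bar>D\<phi> x t $ i\<bar>)" by (rule norm_le_l1_cart)
  also have "\<dots> \<le> (\<Sum>i\<in>(UNIV::'n set). B)"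
    using upper lower by (intro sum_mono) (simp add: abs_le_iff minus_le_iff)
  finally show ?thesis using \<epsilon> by (simp add: B_def field_simps)
qed

section \<open>The time derivative\<close>

text \<open>Bernstein's method in the time direction with speed \<sigma>. The correction is a
  discretised \<open>\<mu> / 2 * |D\<phi>|\<^sup>2\<close>: that function itself would require third
  derivatives of \<phi>, whereas squares of spatial difference quotients have a jet.\<close>

lemma hessian_at_max:
  assumes \<mu>: "\<mu> > 0"
  obtains x t where "x \<in> cbox 0 1" "t \<in> {0..1}"
    "\<And>y s. \<sigma> * \<phi>t y s + \<mu> / 2 * (norm (D\<phi> y s))\<^sup>2 \<le> \<sigma> * \<phi>t x t + \<mu> / 2 * (norm (D\<phi> x t))\<^sup>2"
    "\<epsilon> * \<mu> * (\<Sum>j\<in>UNIV. \<Sum>i\<in>UNIV. (D2\<phi> x t $ j $ i)\<^sup>2) \<le> dH (x, D\<phi> x t, t) (\<mu> *\<^sub>R D\<phi> x t, 0, \<sigma>)"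
proof -
  \<comment> \<open>Difference quotients of \<phi> in the coordinate directions, with their
    jets.\<close>
  define w where "w h i x t = 1 / h * (\<phi> (x + h *\<^sub>R axis i 1) (t + 0) + - 1 * \<phi> x t)" for h i x t
  define wt where "wt h i x t = 1 / h * (\<phi>t (x + h *\<^sub>R axis i 1) (t + 0) + - 1 * \<phi>t x t)" for h i x t
  define wx where "wx h i j x t = 1 / h * (D\<phi> (x + h *\<^sub>R axis i 1) (t + 0) $ j + - 1 * D\<phi> x t $ j)" for h i j x t
  define wxx where "wxx h i j x t = 1 / h * (D2\<phi> (x + h *\<^sub>R axis i 1) (t + 0) $ j $ j + - 1 * D2\<phi> x t $ j $ j)" for h i j x t
  have jet_w: "jet (w h i) (wt h i) (wx h i) (wxx h i)" for h i
    unfolding w_def wt_def wx_def wxx_def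
    by (rule jet_cmult[OF jet_add[OF jet_translate[OF jet_\<phi>] jet_minus_\<phi>]])
  have G: "((\<lambda>r. \<mu> / 2 * r\<^sup>2) has_real_derivative \<mu> * r) (at r)"
    and G': "((\<lambda>r. \<mu> * r) has_real_derivative \<mu>) (at r)" for r
    by (auto intro!: derivative_eq_intros)
  have heat_w: "heat_op \<epsilon> (wt h i) (wxx h i) x t =
      - ((H (x + h *\<^sub>R axis i 1) (D\<phi> (x + h *\<^sub>R axis i 1) t) t - H x (D\<phi> x t) t) / h)" for h i x t
  proof -
    have "heat_op \<epsilon> (wt h i) (wxx h i) x t = 1 / h *
        (heat_op \<epsilon> \<phi>t (\<lambda>i x t. D2\<phi> x t $ i $ i) (x + h *\<^sub>R axis i 1) t - heat_op \<epsilon> \<phi>t (\<lambda>i x t. D2\<phi> x t $ i $ i) x t)"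
      by (simp add: heat_op_def wt_def wxx_def sum_subtractf algebra_simps flip: sum_distrib_left sum_divide_distrib)
    then show ?thesis by (simp add: heat_op_\<phi> minus_divide_left)
  qed
  \<comment> \<open>The product rule: the square of the first derivatives is the gain that becomes
    the squared Hessian.\<close>
  have heat_N: "heat_op \<epsilon> (\<lambda>x t. \<Sum>i\<in>UNIV. \<mu> * w h i x t * wt h i x t)
      (\<lambda>j x t. \<Sum>i\<in>UNIV. \<mu> * (wx h i j x t)\<^sup>2 + \<mu> * w h i x t * wxx h i j x t) x t =
      (\<Sum>i\<in>UNIV. \<mu> * w h i x t * heat_op \<epsilon> (wt h i) (wxx h i) x t) +
      \<epsilon> * \<mu> * (\<Sum>j\<in>UNIV. \<Sum>i\<in>UNIV. (wx h i j x t)\<^sup>2)" for h x t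
    unfolding heat_op_def
    by (subst sum.swap[of "\<lambda>j i. (wx h i j x t)\<^sup>2"], subst sum.swap)
      (simp add: sum.distrib sum_distrib_left distrib_left mult_ac)
  let ?L = "\<lambda>x t. \<mu> / 2 * (norm (D\<phi> x t))\<^sup>2"
  \<comment> \<open>Column \<open>i\<close> of the Hessian is the derivative of D\<phi> along axis
    \<open>i\<close>. The same columns occur as momentum increments in \<open>?LP\<close>.\<close>
  let ?Lx = "\<lambda>x t. \<Sum>i\<in>UNIV. (\<mu> * D\<phi> x t $ i) *\<^sub>R column i (D2\<phi> x t)"
  let ?LP = "\<lambda>x t. (\<Sum>i\<in>UNIV. \<mu> * D\<phi> x t $ i * - dH (x, D\<phi> x t, t) (axis i 1, column i (D2\<phi> x t), 0)) +
      \<epsilon> * \<mu> * (\<Sum>j\<in>UNIV. \<Sum>i\<in>UNIV. (D2\<phi> x t $ j $ i)\<^sup>2)"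
  have w_lim: "(\<lambda>n. w (\<eta> n) i (X n) (T n)) \<longlonglongrightarrow> D\<phi> x t $ i"
    and wx_lim: "(\<lambda>n. wx (\<eta> n) i j (X n) (T n)) \<longlonglongrightarrow> D2\<phi> x t $ j $ i"
    and wH_lim: "(\<lambda>n. heat_op \<epsilon> (wt (\<eta> n) i) (wxx (\<eta> n) i) (X n) (T n)) \<longlonglongrightarrow>
      - dH (x, D\<phi> x t, t) (axis i 1, column i (D2\<phi> x t), 0)"
    if \<eta>: "\<eta> \<longlonglongrightarrow> 0" "\<And>n. \<eta> n > 0" and lim: "X \<longlonglongrightarrow> x" "T \<longlonglongrightarrow> t"
    for \<eta> :: "nat \<Rightarrow> real" and X T x t i j
  proof -
    have cont1: "continuous_on UNIV (\<lambda>(x, t). D\<phi> x t $ i)"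
      and cont2: "continuous_on UNIV (\<lambda>(x, t). D2\<phi> x t $ j $ i)" for j
      unfolding case_prod_beta
      by (intro continuous_intros continuous_D\<phi>[unfolded case_prod_beta] continuous_D2\<phi>[unfolded case_prod_beta])+
    show "(\<lambda>n. w (\<eta> n) i (X n) (T n)) \<longlonglongrightarrow> D\<phi> x t $ i"
      using difference_quotient_limit[of \<phi> "axis i 1" 0, OF _ cont1 \<eta> lim] jetD(2)[OF jet_\<phi>] by (simp add: w_def)
    show wx: "(\<lambda>n. wx (\<eta> n) i j (X n) (T n)) \<longlonglongrightarrow> D2\<phi> x t $ j $ i" for j
      using difference_quotient_limit[of "\<lambda>x t. D\<phi> x t $ j" "axis i 1" 0, OF _ cont2 \<eta> lim] D\<phi>_line[of _ i _ j 0]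
      by (simp add: wx_def)
    define a where "a n = (X n, D\<phi> (X n) (T n), T n)" for n
    define b where "b n = (X n + \<eta> n *\<^sub>R axis i 1, D\<phi> (X n + \<eta> n *\<^sub>R axis i 1) (T n), T n)" for n
    have Xe: "(\<lambda>n. X n + \<eta> n *\<^sub>R axis i 1) \<longlonglongrightarrow> x"
      using tendsto_add[OF lim(1) tendsto_scaleR[OF \<eta>(1) tendsto_const[of "axis i 1"]]] by simp
    have "a \<longlonglongrightarrow> (x, D\<phi> x t, t)" "b \<longlonglongrightarrow> (x, D\<phi> x t, t)"
      unfolding a_def b_def by (intro tendsto_Pair lim Xe D\<phi>_tendsto)+
    moreover have "(\<lambda>n. (b n - a n) /\<^sub>R \<eta> n) \<longlonglongrightarrow> (axis i 1, column i (D2\<phi> x t), 0)"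
    proof -
      have eq: "(\<lambda>n. (b n - a n) /\<^sub>R \<eta> n) = (\<lambda>n. (axis i 1, (\<chi> j. wx (\<eta> n) i j (X n) (T n)), 0))"
        using \<eta>(2) by (auto simp: a_def b_def wx_def vec_eq_iff divide_inverse less_imp_neq[THEN not_sym])
      have "(\<lambda>n. (\<chi> j. wx (\<eta> n) i j (X n) (T n))) \<longlonglongrightarrow> column i (D2\<phi> x t)"
        unfolding column_def by (rule vec_tendstoI) (simp add: wx)
      then show ?thesis unfolding eq by (intro tendsto_Pair tendsto_const)
    qed
    ultimately have "(\<lambda>n. ((\<lambda>(x, p, t). H x p t) (b n) - (\<lambda>(x, p, t). H x p t) (a n)) / \<eta> n)
        \<longlonglongrightarrow> dH (x, D\<phi> x t, t) (axis i 1, column i (D2\<phi> x t), 0)"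
      by (rule H_quotient_limit)
    from tendsto_minus[OF this]
    show "(\<lambda>n. heat_op \<epsilon> (wt (\<eta> n) i) (wxx (\<eta> n) i) (X n) (T n)) \<longlonglongrightarrow>
        - dH (x, D\<phi> x t, t) (axis i 1, column i (D2\<phi> x t), 0)"
      by (simp add: heat_w a_def b_def)
  qed
  obtain x t where xt: "x \<in> cbox 0 1" "t \<in> {0..1}"
    and max: "\<And>y s. \<sigma> * \<phi>t y s + ?L y s \<le> \<sigma> * \<phi>t x t + ?L x t"
    and ineq: "?LP x t \<le> dH (x, D\<phi> x t, t) (0, - ?Lx x t, \<sigma>)"
  proof (rule bernstein[where e = 0 and s = \<sigma> and v = "\<lambda>x t. \<sigma> * \<phi>t x t"
        and N = "\<lambda>h x t. \<Sum>i\<in>UNIV. \<mu> / 2 * (w h i x t)\<^sup>2" and L = ?L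
        and Nt = "\<lambda>h x t. \<Sum>i\<in>UNIV. \<mu> * w h i x t * wt h i x t"
        and Nx = "\<lambda>h j x t. \<Sum>i\<in>UNIV. \<mu> * w h i x t * wx h i j x t"
        and Nxx = "\<lambda>h j x t. \<Sum>i\<in>UNIV. \<mu> * (wx h i j x t)\<^sup>2 + \<mu> * w h i x t * wxx h i j x t"
        and Lx = ?Lx and LP = ?LP])
    show "((\<lambda>r. \<phi> (x + r *\<^sub>R 0) (t + r * \<sigma>)) has_real_derivative \<sigma> * \<phi>t x t) (at 0)" for x t
    proof -
      have "(\<phi> x has_real_derivative \<phi>t x t) (at (t + 0 * \<sigma>))" using jetD(1)[OF jet_\<phi>] by simp
      moreover have "((\<lambda>r. t + r * \<sigma>) has_real_derivative \<sigma>) (at 0)" by (auto intro!: derivative_eq_intros)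
      ultimately have "((\<lambda>r. \<phi> x (t + r * \<sigma>)) has_real_derivative \<phi>t x t * \<sigma>) (at 0)"
        by (rule DERIV_chain2)
      then show ?thesis by (simp add: mult.commute)
    qed
    show "continuous_on UNIV (\<lambda>(x, t). \<sigma> * \<phi>t x t)"
      using continuous_\<phi>t unfolding case_prod_beta by (intro continuous_intros)
    show "jet (\<lambda>x t. \<Sum>i\<in>UNIV. \<mu> / 2 * (w h i x t)\<^sup>2) (\<lambda>x t. \<Sum>i\<in>UNIV. \<mu> * w h i x t * wt h i x t)
        (\<lambda>j x t. \<Sum>i\<in>UNIV. \<mu> * w h i x t * wx h i j x t)
        (\<lambda>j x t. \<Sum>i\<in>UNIV. \<mu> * (wx h i j x t)\<^sup>2 + \<mu> * w h i x t * wxx h i j x t)" for h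
      by (rule jet_sum[OF finite]) (rule jet_compose[OF jet_w G G'])
    show "continuous_on UNIV (\<lambda>(x, t). \<Sum>i\<in>UNIV. \<mu> / 2 * (w h i x t)\<^sup>2)" for h
    proof -
      have "continuous_on UNIV (\<lambda>z. \<phi> (fst z + h *\<^sub>R axis i 1) (snd z + 0))" for i
        using continuous_on_compose2[OF continuous_\<phi>, of UNIV "\<lambda>z. (fst z + h *\<^sub>R axis i 1, snd z + 0)"]
        by (simp add: continuous_intros)
      then show ?thesis
        using continuous_\<phi> unfolding w_def case_prod_beta by (intro continuous_intros) auto
    qed
    show "periodic (\<lambda>x t. \<Sum>i\<in>UNIV. \<mu> / 2 * (w h i x t)\<^sup>2)" for h
    proof -
      have "periodic (w h i)" for i
        unfolding w_def using periodic_combine[OF periodic_translate[OF periodic_\<phi>] periodic_\<phi>, of "\<lambda>u v. 1 / h * (u + - 1 * v)"] .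
      then show ?thesis by (simp add: periodic_def torus_periodic_def)
    qed
    fix \<eta> :: "nat \<Rightarrow> real" and X :: "nat \<Rightarrow> real^'n" and T :: "nat \<Rightarrow> real" and x t j
    assume "\<eta> \<longlonglongrightarrow> 0" "\<And>n. \<eta> n > 0" "X \<longlonglongrightarrow> x" "T \<longlonglongrightarrow> t"
    note lims = w_lim[OF this] wx_lim[OF this] wH_lim[OF this]
    have L_eq: "?L x t = (\<Sum>i\<in>UNIV. \<mu> / 2 * (D\<phi> x t $ i)\<^sup>2)"
      unfolding power2_norm_eq_inner inner_vec_def sum_distrib_left by (simp add: power2_eq_square)
    show "(\<lambda>n. \<Sum>i\<in>UNIV. \<mu> / 2 * (w (\<eta> n) i (X n) (T n))\<^sup>2) \<longlonglongrightarrow> ?L x t"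
      unfolding L_eq by (intro tendsto_intros lims)
    have Lx_eq: "?Lx x t $ j = (\<Sum>i\<in>UNIV. \<mu> * D\<phi> x t $ i * D2\<phi> x t $ j $ i)"
      by (simp add: column_def)
    show "(\<lambda>n. \<Sum>i\<in>UNIV. \<mu> * w (\<eta> n) i (X n) (T n) * wx (\<eta> n) i j (X n) (T n)) \<longlonglongrightarrow> ?Lx x t $ j"
      unfolding Lx_eq by (intro tendsto_intros lims)
    show "(\<lambda>n. heat_op \<epsilon> (\<lambda>x t. \<Sum>i\<in>UNIV. \<mu> * w (\<eta> n) i x t * wt (\<eta> n) i x t)
        (\<lambda>j x t. \<Sum>i\<in>UNIV. \<mu> * (wx (\<eta> n) i j x t)\<^sup>2 + \<mu> * w (\<eta> n) i x t * wxx (\<eta> n) i j x t) (X n) (T n))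
        \<longlonglongrightarrow> ?LP x t"
      unfolding heat_N by (intro tendsto_intros lims)
  qed blast
  \<comment> \<open>By linearity the momentum contributions of \<open>?LP\<close> and of the first
    order condition cancel exactly, so no derivative of \<open>H\<close> multiplies the Hessian any
    more.\<close>
  let ?d = "dH (x, D\<phi> x t, t)"
  have "(\<Sum>i\<in>UNIV. \<mu> * D\<phi> x t $ i * - ?d (axis i 1, column i (D2\<phi> x t), 0)) =
      - ?d (\<Sum>i\<in>UNIV. (\<mu> * D\<phi> x t $ i) *\<^sub>R (axis i 1, column i (D2\<phi> x t), 0))"
    by (simp only: linear_sum[OF linear_dH] linear_scale[OF linear_dH] real_scaleR_def mult_minus_right sum_negf)
  also have "(\<Sum>i\<in>UNIV. (\<mu> * D\<phi> x t $ i) *\<^sub>R (axis i 1 :: real^'n, column i (D2\<phi> x t), 0 :: real)) = (\<mu> *\<^sub>R D\<phi> x t, ?Lx x t, 0)"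
  proof -
    have "(\<Sum>i\<in>UNIV. (\<mu> * D\<phi> x t $ i) *\<^sub>R axis i 1) = \<mu> *\<^sub>R D\<phi> x t"
      using basis_expansion[of "\<mu> *\<^sub>R D\<phi> x t"] by (simp add: scalar_mult_eq_scaleR)
    then show ?thesis by (simp add: prod_eq_iff fst_sum snd_sum)
  qed
  finally have "\<epsilon> * \<mu> * (\<Sum>j\<in>UNIV. \<Sum>i\<in>UNIV. (D2\<phi> x t $ j $ i)\<^sup>2) \<le>
      ?d (\<mu> *\<^sub>R D\<phi> x t, ?Lx x t, 0) + ?d (0, - ?Lx x t, \<sigma>)"
    using ineq by linarith
  also have "\<dots> = ?d (\<mu> *\<^sub>R D\<phi> x t, 0, \<sigma>)"
    by (simp flip: linear_add[OF linear_dH])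
  finally show ?thesis using that xt max by blast
qed

text \<open>At the maximum point the squared Hessian bounds \<epsilon>\<Delta>\<phi>, and the
  equation converts this into a bound on \<phi>_t there. The gradient bounds control the correction,
  so the estimate carries over to all points.\<close>

lemma time_derivative_bound:
  fixes R C C2 C3 :: real
  assumes R: "\<And>x t. norm (D\<phi> x t) \<le> R" and C: "\<And>x p t. norm p \<le> R \<Longrightarrow> \<bar>H x p t\<bar> \<le> C"
    and C2: "\<And>x t. \<epsilon> * norm (D\<phi> x t) \<le> C2"
    and C3: "C3 \<ge> 0" "\<And>x p t v. x \<in> cbox 0 1 \<Longrightarrow> norm p \<le> R \<Longrightarrow> t \<in> {0..1} \<Longrightarrow> \<bar>dH (x, p, t) v\<bar> \<le> C3 * norm v"
  shows "\<bar>\<phi>t x t\<bar> \<le> 2 * C + (CARD('n) * C3 * (C2 + 1) + 1) + (R\<^sup>2 + C2 * R) / 2"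
proof -
  \<comment> \<open>This weight dominates \<epsilon>, while \<open>\<mu> * |D\<phi>|\<^sup>2\<close>
    remains bounded through \<open>R\<close> and \<open>C2\<close>.\<close>
  define \<mu> where "\<mu> = 1 + \<epsilon>"
  have \<mu>: "\<mu> > 0" using \<epsilon> by (simp add: \<mu>_def)
  have "R \<ge> 0" using R norm_ge_zero order_trans by blast
  define Q where "Q = CARD('n) * C3 * (C2 + 1)"
  have "\<sigma> * \<phi>t x t \<le> 2 * C + (Q + 1) + (R\<^sup>2 + C2 * R) / 2" if \<sigma>: "\<bar>\<sigma>\<bar> = 1" for \<sigma>
  proof -
    obtain y s where ys: "y \<in> cbox 0 1" "s \<in> {0..1}"
      and max: "\<And>x t. \<sigma> * \<phi>t x t + \<mu> / 2 * (norm (D\<phi> x t))\<^sup>2 \<le> \<sigma> * \<phi>t y s + \<mu> / 2 * (norm (D\<phi> y s))\<^sup>2"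
      and ineq: "\<epsilon> * \<mu> * (\<Sum>j\<in>UNIV. \<Sum>i\<in>UNIV. (D2\<phi> y s $ j $ i)\<^sup>2) \<le> dH (y, D\<phi> y s, s) (\<mu> *\<^sub>R D\<phi> y s, 0, \<sigma>)"
      using hessian_at_max[OF \<mu>, of \<sigma>] by blast
    let ?D2 = "D2\<phi> y s" and ?p = "D\<phi> y s"
    let ?S = "\<Sum>j\<in>UNIV. \<Sum>i\<in>UNIV. (?D2 $ j $ i)\<^sup>2"
    have "norm (\<mu> *\<^sub>R ?p, 0::real^'n, \<sigma>) \<le> \<mu> * norm ?p + 1"
      using norm_Pair_le[of "\<mu> *\<^sub>R ?p" "(0::real^'n, \<sigma>)"] norm_Pair_le[of "0::real^'n" \<sigma>] \<sigma> \<mu> by simp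
    then have "C3 * norm (\<mu> *\<^sub>R ?p, 0::real^'n, \<sigma>) \<le> C3 * (\<mu> * norm ?p + 1)"
      by (rule mult_left_mono[OF _ C3(1)])
    then have "\<epsilon> * \<mu> * ?S \<le> C3 * (\<mu> * norm ?p + 1)"
      using ineq C3(2)[OF ys(1) R ys(2), of y s "(\<mu> *\<^sub>R ?p, 0, \<sigma>)"] by linarith
    \<comment> \<open>The extra factor \<epsilon> produces the square of \<epsilon> times the
      Hessian on the left; on the right it is absorbed by \<open>C2\<close> and \<mu>.\<close>
    then have "\<epsilon> * (\<epsilon> * \<mu> * ?S) \<le> \<epsilon> * (C3 * (\<mu> * norm ?p + 1))"
      using \<epsilon> by (intro mult_left_mono) auto
    also have "\<dots> = C3 * (\<mu> * (\<epsilon> * norm ?p) + \<epsilon>)" by (simp add: algebra_simps)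
    also have "\<dots> \<le> C3 * (\<mu> * C2 + \<mu>)"
      using C2[of y s] C3(1) \<mu> by (intro mult_left_mono add_mono) (auto simp: \<mu>_def)
    finally have "\<mu> * (\<epsilon>\<^sup>2 * ?S) \<le> \<mu> * (C3 * (C2 + 1))"
      by (simp add: power2_eq_square algebra_simps)
    then have S: "\<epsilon>\<^sup>2 * ?S \<le> C3 * (C2 + 1)" using \<mu> by simp
    define l where "l = \<epsilon> * (\<Sum>i\<in>UNIV. ?D2 $ i $ i)"
    have "(\<Sum>i\<in>UNIV. ?D2 $ i $ i)\<^sup>2 \<le> CARD('n) * (\<Sum>i\<in>UNIV. (?D2 $ i $ i)\<^sup>2)"
      using Cauchy_Schwarz_ineq_sum[of "\<lambda>_. 1" "\<lambda>i. ?D2 $ i $ i" "UNIV :: 'n set"] by simp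
    also have "\<dots> \<le> CARD('n) * ?S"
      by (intro mult_left_mono sum_mono) (auto intro: member_le_sum)
    finally have "l\<^sup>2 \<le> CARD('n) * (\<epsilon>\<^sup>2 * ?S)"
      unfolding l_def power_mult_distrib using mult_left_mono[of _ _ "\<epsilon>\<^sup>2"] by (fastforce simp: mult_ac)
    also have "\<dots> \<le> Q" unfolding Q_def using S by (simp add: mult.assoc)
    \<comment> \<open>The inequality \<open>(|l| - 1)\<^sup>2 \<ge> 0\<close> gives a linear bound
      in \<open>Q\<close> without a square root.\<close>
    finally have l: "\<bar>l\<bar> \<le> Q + 1"
      using zero_le_power2[of "\<bar>l\<bar> - 1"] by (simp add: power2_eq_square algebra_simps abs_if split: if_splits)
    have "\<bar>c\<bar> \<le> C"
    proof -
      have "\<exists>x t. c \<le> H x 0 t" "\<exists>x t. H x 0 t \<le> c" by (rule c_le, blast, rule c_ge, blast)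
      then show ?thesis using C[of 0] \<open>R \<ge> 0\<close> by (smt (verit) norm_zero)
    qed
    moreover have "\<phi>t y s = c - H y ?p s - l"
      using heat_op_\<phi>[of y s] by (simp add: heat_op_def l_def)
    ultimately have "\<sigma> * \<phi>t y s \<le> 2 * C + (Q + 1)"
      using l C[OF R[of y s], of y s] \<sigma> by (auto simp: abs_if split: if_splits)
    moreover have "\<mu> / 2 * (norm ?p)\<^sup>2 \<le> (R\<^sup>2 + C2 * R) / 2"
    proof -
      have "\<epsilon> * norm ?p * norm ?p \<le> C2 * R"
        using C2[of y s] R[of y s] \<epsilon> by (intro mult_mono) (auto intro: order_trans[OF _ C2[of y s]])
      moreover have "(norm ?p)\<^sup>2 \<le> R\<^sup>2" using R[of y s] by (intro power_mono) auto
      ultimately show ?thesis by (simp add: \<mu>_def power2_eq_square algebra_simps)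
    qed
    moreover have "0 \<le> \<mu> / 2 * (norm (D\<phi> x t))\<^sup>2" using \<mu> by simp
    ultimately show ?thesis using max[of x t] by linarith
  qed
  from this[of 1] this[of "- 1"] show ?thesis by (simp add: Q_def abs_le_iff)
qed

end

theorem lemma10:
  fixes H :: "('n::finite) hamiltonian" and k :: nat
  assumes "k \<ge> 3"
    and "C_k k (\<lambda>(x, p, t). H x p t)"
    and "torus_periodic H"
    and "standard_hypotheses H"
    and "growth_condition H"
  shows "\<exists>C. \<forall>\<epsilon>>0. \<forall>c \<phi>. time_periodic_solution H \<epsilon> c \<phi> \<longrightarrow>
           (\<forall>x t. norm (grad (\<lambda>y. \<phi> y t) x) \<le> C \<and> \<bar>deriv (\<phi> x) t\<bar> \<le> C)"
proof -
  obtain j where "k = Suc j" using assms(1) by (cases k) auto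
  then have "C_k (Suc 0) (\<lambda>(x, p, t). H x p t)"
    using assms(2) by (simp only: C_k.simps) (blast intro: C_k_continuous_on)
  then interpret periodic_hamiltonian H
    using assms(3,4) by unfold_locales (auto simp: standard_hypotheses_def)
  obtain K where K: "K > 0" "\<And>x p t. norm p \<ge> K \<Longrightarrow>
      (H_p H x p t \<bullet> p - H x p t + (INF (y, s). H y 0 s)) * K - norm (H_x H x p t) \<ge> 0"
    using assms(5) unfolding growth_condition_def by blast
  obtain C0 where "\<And>x p t. norm p \<le> 0 \<Longrightarrow> \<bar>H x p t\<bar> \<le> C0" using H_bounded[of 0] by metis
  then have C0: "H x 0 t \<le> C0" for x t by (metis abs_le_D1 norm_zero order_refl)
  \<comment> \<open>\<open>R\<close> depends on \<open>H\<close> alone, hence so do the compactness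
    constants \<open>C\<close> and \<open>C3\<close> for momenta of norm at most \<open>R\<close>.
    All are fixed before \<epsilon> is introduced.\<close>
  define R where "R = K + (K + 1) * (exp ((K + 1) * CARD('n)) + C0 - (INF (y, s). H y 0 s))"
  obtain C where C: "\<And>x p t. norm p \<le> R \<Longrightarrow> \<bar>H x p t\<bar> \<le> C" using H_bounded[of R] by metis
  obtain C3 where C3: "C3 \<ge> 0"
    "\<And>x p t v. x \<in> cbox 0 1 \<Longrightarrow> norm p \<le> R \<Longrightarrow> t \<in> {0..1} \<Longrightarrow> \<bar>dH (x, p, t) v\<bar> \<le> C3 * norm v"
    using dH_bounded[of R] by metis
  define C2 where "C2 = CARD('n) * (C + 1)"
  let ?B = "2 * C + (CARD('n) * C3 * (C2 + 1) + 1) + (R\<^sup>2 + C2 * R) / 2"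
  show ?thesis
  proof (intro exI[of _ "max R ?B"] allI impI)
    fix \<epsilon> c :: real and \<phi> x t
    assume "\<epsilon> > 0" "time_periodic_solution H \<epsilon> c \<phi>"
    then interpret periodic_solution H \<epsilon> c \<phi> by unfold_locales
    have grad: "norm (D\<phi> x t) \<le> R" for x t
      unfolding R_def by (rule gradient_bound[OF K(1) _ C0]) (rule K(2))
    have scaled: "\<epsilon> * norm (D\<phi> x t) \<le> C2" for x t
      unfolding C2_def by (rule scaled_gradient_bound[OF grad]) (rule C)
    have "\<bar>\<phi>t x t\<bar> \<le> ?B"
      by (rule time_derivative_bound[OF grad _ scaled C3(1)]) (fact C, fact C3(2))
    with grad[of x t] show "norm (grad (\<lambda>y. \<phi> y t) x) \<le> max R ?B \<and> \<bar>deriv (\<phi> x) t\<bar> \<le> max R ?B"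
      by (simp add: D\<phi>_def \<phi>t_def le_max_iff_disj)
  qed
qed

end
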